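(* Suppose that $B=(\langle\ ,\ \rangle\colon V\times V'\to\mathbb{R},\ \iota\colon\Pi\to\Pi^\vee)$ and $B'=(\langle\ ,\ \rangle\colon V\times V'\to\mathbb{R},\ \iota'\colon\Delta\to\Delta^\vee)$ are two based root data with the same underlying root datum $(\langle\ ,\ \rangle\colon V\times V'\to\mathbb{R},\ \hat\iota\colon\Phi\to\Phi^\vee)$. Assume that the associated Coxeter systems $(W,S)$ and $(W,S')$ respectively are both of finite rank and irreducible. Then there exist $w\in W$, $\epsilon\in\{\pm1\}$ and scalars $c_\alpha\in\mathbb{R}_{>0}$ for $\alpha\in\Pi$ such that $\Delta=\{\epsilon c_\alpha w(\alpha)\mid\alpha\in\Pi\}$. In particular, $S'=wSw^{-1}$, and hence $(W,S)$ is isomorphic to $(W,S')$.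
   Context: A subset $X$ of a real vector space is positively independent if a finite sum $\sum_{x\in X}c_xx=0$ with all $c_x\ge0$ forces all $c_x=0$. Let $V,V'$ be real vector spaces with a bilinear pairing $\langle\ ,\ \rangle\colon V\times V'\to\mathbb{R}$. For $\alpha\in V$, $\alpha'\in V'$ with $\langle\alpha,\alpha'\rangle=2$, let $s_{\alpha,\alpha'}\in GL(V)$ be $v\mapsto v-\langle v,\alpha'\rangle\alpha$ and $s_{\alpha',\alpha}\in GL(V')$ be $v'\mapsto v'-\langle\alpha,v'\rangle\alpha'$. A based root datum $(\langle\ ,\ \rangle\colon V\times V'\to\mathbb{R},\iota\colon\Pi\to\Pi^\vee)$ consists of such a pairing, subsets $\Pi\subseteq V$, $\Pi^\vee\subseteq V'$ and a bijection $\iota$, $\alpha\mapsto\alpha^\vee$, with $\langle\alpha,\alpha^\vee\rangle=2$ for $\alpha\in\Pi$, such that $\Pi$ and $\Pi^\vee$ are positively independent and the following hold, where $S=\{s_{\alpha,\alpha^\vee}:\alpha\in\Pi\}$, $W=\langle S\rangle\subseteq GL(V)$, $\Phi=W\Pi$, $\Phi_+=\Phi\cap\sum_{\alpha\in\Pi}\mathbb{R}_{\ge0}\alpha$, and $\Phi^\vee,\Phi^\vee_+$ are defined analogously from $\Pi^\vee$ using the reflections $s_{\alpha^\vee,\alpha}$ of $V'$: (i) $\Phi=\Phi_+\cup(-\Phi_+)$; (ii) $\Phi^\vee=\Phi^\vee_+\cup(-\Phi^\vee_+)$; (iii) for $\alpha\ne\beta$ in $\Pi$, $\langle\alpha,\beta^\vee\rangle\le0$,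 $\langle\alpha,\beta^\vee\rangle\langle\beta,\alpha^\vee\rangle\in\{4\cos^2(\pi/m):m\in\mathbb{N}_{\ge2}\}\cup[4,\infty)$, and $\langle\alpha,\beta^\vee\rangle=0$ iff $\langle\beta,\alpha^\vee\rangle=0$. Then $(W,S)$ is a Coxeter system (the associated one); $W$ acts on $V'$ with $s_{\alpha,\alpha^\vee}$ acting as $s_{\alpha^\vee,\alpha}$; and $\iota$ extends to a $W$-equivariant bijection $\hat\iota\colon\Phi\to\Phi^\vee$. The tuple $(\langle\ ,\ \rangle,\hat\iota\colon\Phi\to\Phi^\vee)$ is the underlying root datum. Two based root data with the same underlying root datum have the same group $W$. Finite rank means the set of simple reflections is finite. *)

theory Defs
  imports "HOL-Analysis.Analysis" "HOL-Algebra.Elementary_Groups" "HOL-Algebra.Multiplicative_Group"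
begin

definition positively_independent :: "'v::real_vector set \<Rightarrow> bool" where
  "positively_independent X \<longleftrightarrow>
     (\<forall>F c. finite F \<and> F \<subseteq> X \<and> (\<forall>x\<in>F. 0 \<le> c x) \<and> (\<Sum>x\<in>F. c x *\<^sub>R x) = 0 \<longrightarrow> (\<forall>x\<in>F. c x = 0))"

definition nonneg_span :: "'v::real_vector set \<Rightarrow> 'v set" where
  "nonneg_span X = {\<Sum>x\<in>F. c x *\<^sub>R x | F c. finite F \<and> F \<subseteq> X \<and> (\<forall>x\<in>F. 0 \<le> c x)}"

definition GL :: "('v::real_vector \<Rightarrow> 'v) monoid" where
  "GL = \<lparr>carrier = {f. linear f \<and> bij f}, mult = (\<circ>), one = id\<rparr>"

definition reflection ::
  "('v::real_vector \<Rightarrow> 'w::real_vector \<Rightarrow> real) \<Rightarrow> 'v \<Rightarrow> 'w \<Rightarrow> 'v \<Rightarrow> 'v" where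
  "reflection p a a' = (\<lambda>v. v - p v a' *\<^sub>R a)"

text \<open>The raw data of a based root datum: the pairing on \<open>V \<times> V'\<close>, the sets \<open>\<Pi>\<close> and \<open>\<Pi>\<^sup>\<or>\<close>, and
  the map \<open>\<iota>\<close>, of which only the values on \<open>\<Pi>\<close> are relevant.\<close>

record ('v, 'w) root_basis =
  pairing :: "'v \<Rightarrow> 'w \<Rightarrow> real"
  simple_roots :: "'v set"
  simple_coroots :: "'w set"
  coroot :: "'v \<Rightarrow> 'w"

text \<open>Exchanging the roles of \<open>V\<close> and \<open>V'\<close>; the constructions on the coroot side are those on
  the root side applied to the dual.\<close>

definition dual :: "('v, 'w) root_basis \<Rightarrow> ('w, 'v) root_basis" where
  "dual B = \<lparr>pairing = (\<lambda>v' v. pairing B v v'),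
             simple_roots = simple_coroots B,
             simple_coroots = simple_roots B,
             coroot = inv_into (simple_roots B) (coroot B)\<rparr>"

definition simple_reflection ::
  "('v::real_vector, 'w::real_vector) root_basis \<Rightarrow> 'v \<Rightarrow> 'v \<Rightarrow> 'v" where
  "simple_reflection B \<alpha> = reflection (pairing B) \<alpha> (coroot B \<alpha>)"

definition simple_reflections ::
  "('v::real_vector, 'w::real_vector) root_basis \<Rightarrow> ('v \<Rightarrow> 'v) set" where
  "simple_reflections B = simple_reflection B ` simple_roots B"

definition weyl_group ::
  "('v::real_vector, 'w::real_vector) root_basis \<Rightarrow> ('v \<Rightarrow> 'v) monoid" where
  "weyl_group B = subgroup_generated GL (simple_reflections B)"

definition roots :: "('v::real_vector, 'w::real_vector) root_basis \<Rightarrow> 'v set" where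
  "roots B = {w \<alpha> | w \<alpha>. w \<in> carrier (weyl_group B) \<and> \<alpha> \<in> simple_roots B}"

definition positive_roots :: "('v::real_vector, 'w::real_vector) root_basis \<Rightarrow> 'v set" where
  "positive_roots B = roots B \<inter> nonneg_span (simple_roots B)"

abbreviation coroots :: "('v::real_vector, 'w::real_vector) root_basis \<Rightarrow> 'w set" where
  "coroots B \<equiv> roots (dual B)"

abbreviation positive_coroots :: "('v::real_vector, 'w::real_vector) root_basis \<Rightarrow> 'w set" where
  "positive_coroots B \<equiv> positive_roots (dual B)"

definition based_root_datum :: "('v::real_vector, 'w::real_vector) root_basis \<Rightarrow> bool" where
  "based_root_datum B \<longleftrightarrow>
     bilinear (pairing B) \<and>
     bij_betw (coroot B) (simple_roots B) (simple_coroots B) \<and>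
     (\<forall>\<alpha>\<in>simple_roots B. pairing B \<alpha> (coroot B \<alpha>) = 2) \<and>
     positively_independent (simple_roots B) \<and>
     positively_independent (simple_coroots B) \<and>
     roots B = positive_roots B \<union> uminus ` positive_roots B \<and>
     coroots B = positive_coroots B \<union> uminus ` positive_coroots B \<and>
     (\<forall>\<alpha>\<in>simple_roots B. \<forall>\<beta>\<in>simple_roots B. \<alpha> \<noteq> \<beta> \<longrightarrow>
        pairing B \<alpha> (coroot B \<beta>) \<le> 0 \<and>
        pairing B \<alpha> (coroot B \<beta>) * pairing B \<beta> (coroot B \<alpha>)
          \<in> {4 * (cos (pi / real m))\<^sup>2 | m::nat. 2 \<le> m} \<union> {4..} \<and>
        (pairing B \<alpha> (coroot B \<beta>) = 0 \<longleftrightarrow> pairing B \<beta> (coroot B \<alpha>) = 0))"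

text \<open>The action of \<open>W\<close> on \<open>V'\<close>, given on generators; it need not be determined by
  invariance of the pairing, which may be degenerate.\<close>

definition dual_action ::
  "('v::real_vector, 'w::real_vector) root_basis \<Rightarrow> (('v \<Rightarrow> 'v) \<Rightarrow> ('w \<Rightarrow> 'w)) \<Rightarrow> bool" where
  "dual_action B \<rho> \<longleftrightarrow>
     \<rho> \<in> hom (weyl_group B) GL \<and>
     (\<forall>\<alpha>\<in>simple_roots B.
        \<rho> (simple_reflection B \<alpha>) = simple_reflection (dual B) (coroot B \<alpha>))"

text \<open>The underlying root datum of \<open>B\<close> is \<open>(p, h: R \<rightarrow> R')\<close>. The map \<open>h\<close> is determined by \<open>B\<close>
  on \<open>R\<close>, and its values elsewhere are irrelevant.\<close>

definition has_underlying_root_datum ::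
  "('v::real_vector, 'w::real_vector) root_basis \<Rightarrow> ('v \<Rightarrow> 'w \<Rightarrow> real) \<Rightarrow>
   'v set \<Rightarrow> 'w set \<Rightarrow> ('v \<Rightarrow> 'w) \<Rightarrow> bool" where
  "has_underlying_root_datum B p R R' h \<longleftrightarrow>
     pairing B = p \<and> roots B = R \<and> coroots B = R' \<and>
     bij_betw h R R' \<and>
     (\<forall>\<alpha>\<in>simple_roots B. h \<alpha> = coroot B \<alpha>) \<and>
     (\<exists>\<rho>. dual_action B \<rho> \<and>
        (\<forall>w\<in>carrier (weyl_group B). \<forall>\<beta>\<in>R. h (w \<beta>) = \<rho> w (h \<beta>)))"

text \<open>The edges of the Coxeter graph join the distinct \<open>s, t\<close> with \<open>m(s,t) \<ge> 3\<close> or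
  \<open>m(s,t) = \<infinity>\<close>. Distinct involutions never have \<open>m(s,t) = 1\<close>, and \<^const>\<open>group.ord\<close> is \<open>0\<close>
  for elements of infinite order.\<close>

definition coxeter_graph :: "('a, 'b) monoid_scheme \<Rightarrow> 'a set \<Rightarrow> ('a \<times> 'a) set" where
  "coxeter_graph G S =
     {(s, t). s \<in> S \<and> t \<in> S \<and> s \<noteq> t \<and> group.ord G (s \<otimes>\<^bsub>G\<^esub> t) \<noteq> 2}"

definition irreducible_coxeter :: "('a, 'b) monoid_scheme \<Rightarrow> 'a set \<Rightarrow> bool" where
  "irreducible_coxeter G S \<longleftrightarrow> (\<forall>s\<in>S. \<forall>t\<in>S. (s, t) \<in> (coxeter_graph G S)\<^sup>*)"

definition coxeter_isomorphic ::
  "('a, 'b) monoid_scheme \<Rightarrow> 'a set \<Rightarrow> ('c, 'd) monoid_scheme \<Rightarrow> 'c set \<Rightarrow> bool" where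
  "coxeter_isomorphic G S H T \<longleftrightarrow> (\<exists>\<phi>\<in>iso G H. \<phi> ` S = T)"

end

theory Submission
  imports Defs
begin

text \<open>Let \<open>D\<close>, \<open>E\<close> be two bases of the same root system. If only finitely many rays of roots are
  positive for \<open>D\<close> and negative for \<open>E\<close>, simple reflections remove them one at a time and some
  \<open>w \<in> W\<close> carries \<open>D\<close> to \<open>E\<close> up to positive scalars; if only finitely many are positive for both,
  the same applies to \<open>-E\<close>. Suppose both sets are infinite. Every element of \<open>W\<close> changes the sign of
  finitely many rays only, so limits \<open>x\<close> and \<open>y\<close> of the two kinds of rays have their orbits in
  \<open>cone D \<inter> -cone E\<close> and \<open>cone D \<inter> cone E\<close>, respectively. The reflections in the rays approaching
  one of these limits force the other limit to be fixed by \<open>W\<close>, and by irreducibility a nonzero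
  fixed vector of \<open>cone D\<close> is unique up to scaling, as in the Perron--Frobenius theorem. So \<open>y\<close> is a
  positive multiple of \<open>x\<close>, contradicting that \<open>cone E\<close> is pointed.\<close>

section \<open>Finitely generated cones\<close>

text \<open>A linear functional strictly positive on the base makes up for much of this: it
  normalises rays to level one, keeps limits nonzero and bounds coefficients. Convergence is that of
  chosen coefficients, or of the values of every linear functional, and the cones are closed in this
  sense. Linear independence of simple roots is replaced by the fact that they span extremal rays, a
  consequence of the nonpositive pairings. The comparison of bases forgets \<open>V'\<close> and
  keeps only \<open>W\<close> and the functionals \<open>cr \<beta>\<close>, so that
  \<open>D\<close>, \<open>E\<close> and the negative of \<open>E\<close> are treated alike. The
  coroot side returns at the end: the pairing may be degenerate, and it takes the action of
  \<open>W\<close> on \<open>V'\<close> to see that proportional roots have the same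
  reflection.\<close>

lemma nonneg_span_finite:
  assumes "finite X"
  shows "nonneg_span X = {\<Sum>x\<in>X. c x *\<^sub>R x | c. \<forall>x\<in>X. 0 \<le> c x}"
proof (intro subset_antisym subsetI)
  fix y assume "y \<in> nonneg_span X"
  then obtain F c where F: "F \<subseteq> X" "\<forall>x\<in>F. 0 \<le> c x" "y = (\<Sum>x\<in>F. c x *\<^sub>R x)"
    unfolding nonneg_span_def by auto
  have "y = (\<Sum>x\<in>X. (if x \<in> F then c x else 0) *\<^sub>R x)"
    unfolding F(3) by (rule sum.mono_neutral_cong_left) (use F assms in auto)
  then show "y \<in> {\<Sum>x\<in>X. c x *\<^sub>R x | c. \<forall>x\<in>X. 0 \<le> c x}"
    using F(2) by (intro CollectI exI[of _ "\<lambda>x. if x \<in> F then c x else 0"]) auto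
next
  fix y assume "y \<in> {\<Sum>x\<in>X. c x *\<^sub>R x | c. \<forall>x\<in>X. 0 \<le> c x}"
  then show "y \<in> nonneg_span X" unfolding nonneg_span_def using assms by blast
qed

lemma nonneg_spanE:
  assumes "finite X" "y \<in> nonneg_span X"
  obtains c where "\<And>x. x \<in> X \<Longrightarrow> 0 \<le> c x" "y = (\<Sum>x\<in>X. c x *\<^sub>R x)"
  using assms nonneg_span_finite[OF assms(1)] by auto

lemma nonneg_spanI:
  assumes "finite X" "\<And>x. x \<in> X \<Longrightarrow> 0 \<le> c x"
  shows "(\<Sum>x\<in>X. c x *\<^sub>R x) \<in> nonneg_span X"
  using assms nonneg_span_finite[OF assms(1)] by auto

lemma nonneg_span_base: "x \<in> X \<Longrightarrow> x \<in> nonneg_span X"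
  unfolding nonneg_span_def
  by (intro CollectI exI[of _ "{x}"] exI[of _ "\<lambda>_. 1"]) auto

lemma nonneg_span_scale:
  assumes "finite X" "y \<in> nonneg_span X" "0 \<le> k" shows "k *\<^sub>R y \<in> nonneg_span X"
proof -
  obtain c where c: "\<And>x. x \<in> X \<Longrightarrow> 0 \<le> c x" "y = (\<Sum>x\<in>X. c x *\<^sub>R x)"
    using nonneg_spanE assms by blast
  have "(\<Sum>x\<in>X. (k * c x) *\<^sub>R x) \<in> nonneg_span X"
    using c assms by (intro nonneg_spanI) auto
  then show ?thesis by (simp add: c(2) scaleR_sum_right)
qed

lemma nonneg_span_scale_iff:
  assumes "finite X" "0 < k" shows "k *\<^sub>R y \<in> nonneg_span X \<longleftrightarrow> y \<in> nonneg_span X"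
proof
  assume "k *\<^sub>R y \<in> nonneg_span X"
  from nonneg_span_scale[OF assms(1) this, of "inverse k"] show "y \<in> nonneg_span X"
    using assms by simp
qed (use assms nonneg_span_scale in force)

lemma nonneg_span_add:
  assumes "finite X" "y \<in> nonneg_span X" "z \<in> nonneg_span X" shows "y + z \<in> nonneg_span X"
proof -
  obtain c where c: "\<And>x. x \<in> X \<Longrightarrow> 0 \<le> c x" "y = (\<Sum>x\<in>X. c x *\<^sub>R x)"
    using nonneg_spanE assms by blast
  obtain d where d: "\<And>x. x \<in> X \<Longrightarrow> 0 \<le> d x" "z = (\<Sum>x\<in>X. d x *\<^sub>R x)"
    using nonneg_spanE assms by blast
  have "(\<Sum>x\<in>X. (c x + d x) *\<^sub>R x) \<in> nonneg_span X"
    using c d assms by (intro nonneg_spanI) (auto intro: add_nonneg_nonneg)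
  then show ?thesis by (simp add: c(2) d(2) scaleR_add_left sum.distrib)
qed

lemma nonneg_span_zero: "0 \<in> nonneg_span X"
  unfolding nonneg_span_def by (intro CollectI exI[of _ "{}"]) auto

lemma nonneg_span_sum:
  assumes "finite X" "\<And>i. i \<in> I \<Longrightarrow> y i \<in> nonneg_span X" shows "(\<Sum>i\<in>I. y i) \<in> nonneg_span X"
  using assms(2)
  by (induction I rule: infinite_finite_induct)
    (auto intro: nonneg_span_add assms(1) nonneg_span_zero)

lemma nonneg_span_uminus:
  assumes "finite X"
  shows "y \<in> nonneg_span (uminus ` X) \<longleftrightarrow> - y \<in> nonneg_span X"
proof -
  have 1: "y \<in> nonneg_span (uminus ` X)" if asm: "finite X" "- y \<in> nonneg_span X" for X :: "'a set" and y
  proof -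
    obtain c where c: "\<And>x. x \<in> X \<Longrightarrow> 0 \<le> c x" "- y = (\<Sum>x\<in>X. c x *\<^sub>R x)"
      using asm nonneg_span_finite[OF asm(1)] by auto
    have "y = (\<Sum>x\<in>X. c x *\<^sub>R (- x))" using arg_cong[OF c(2), of uminus] by (simp add: sum_negf)
    moreover have "c x *\<^sub>R (- x) \<in> nonneg_span (uminus ` X)" if "x \<in> X" for x
      using that c(1) \<open>finite X\<close> by (intro nonneg_span_scale nonneg_span_base) auto
    ultimately show ?thesis using \<open>finite X\<close> by (simp add: nonneg_span_sum)
  qed
  show ?thesis
    using 1[of X y] 1[of "uminus ` X" "- y"] assms by (auto simp: image_image)
qed

section \<open>Strictly positive functionals on pointed cones\<close>

lemma exists_functional:
  fixes a :: "'a::real_vector"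
  assumes "a \<noteq> 0"
  obtains k :: "'a \<Rightarrow> real" where "linear k" "k a = 1"
proof -
  have "independent {a}" using assms by simp
  from linear_independent_extend[OF this, of "\<lambda>_. 1::real"] show thesis using that by auto
qed

text \<open>A form of Gordan's alternative, by projecting along the new vector \<open>v j\<close>
  and lifting a functional back. Families are used instead of sets because distinct vectors may have
  the same projection.\<close>

lemma positive_functional_family:
  fixes v :: "'i \<Rightarrow> 'a::real_vector"
  assumes "finite I"
    and "\<And>c. (\<forall>i\<in>I. 0 \<le> c i) \<Longrightarrow> (\<Sum>i\<in>I. c i *\<^sub>R v i) = 0 \<Longrightarrow> \<forall>i\<in>I. c i = 0"
  shows "\<exists>f::'a \<Rightarrow> real. linear f \<and> (\<forall>i\<in>I. 0 < f (v i))"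
  using assms
proof (induction I arbitrary: v rule: finite_induct)
  case empty
  show ?case by (intro exI[of _ "\<lambda>_. 0"]) (simp add: linear_iff)
next
  case (insert j I)
  define a where "a = v j"
  have sum_ins: "(\<Sum>i\<in>insert j I. c i *\<^sub>R v i) = c j *\<^sub>R a + (\<Sum>i\<in>I. c i *\<^sub>R v i)" for c
    using insert.hyps by (simp add: a_def)
  have "a \<noteq> 0"
  proof
    assume "a = 0"
    have "(\<Sum>i\<in>insert j I. (if i = j then 1 else 0) *\<^sub>R v i) = a + (\<Sum>i\<in>I. 0)"
      unfolding sum_ins using insert.hyps by (intro arg_cong2[of _ _ _ _ "(+)"] sum.cong) auto
    then have "\<forall>i\<in>insert j I. (if i = j then 1 else 0) = (0::real)"
      using \<open>a = 0\<close> by (intro insert.prems) auto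
    then show False by auto
  qed
  then obtain k :: "'a \<Rightarrow> real" where k: "linear k" "k a = 1" by (rule exists_functional)
  define v' where "v' i = v i - k (v i) *\<^sub>R a" for i
  show ?case
  proof (cases "\<forall>c. (\<forall>i\<in>I. 0 \<le> c i) \<longrightarrow> (\<Sum>i\<in>I. c i *\<^sub>R v' i) = 0 \<longrightarrow> (\<forall>i\<in>I. c i = 0)")
    case True
    then obtain g :: "'a \<Rightarrow> real" where g: "linear g" "\<forall>i\<in>I. 0 < g (v' i)"
      using insert.IH[of v'] by blast
    \<comment> \<open>\<open>M\<close> exceeds each ratio of \<open>\<bar>k (v i)\<bar>\<close> to
      \<open>g (v' i)\<close>, so the term from \<open>g\<close> outweighs \<open>k\<close> at every
      \<open>v i\<close>. At \<open>a\<close> the projection vanishes and \<open>k a = 1\<close>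
      remains.\<close>
    define M where "M = 1 + (\<Sum>i\<in>I. \<bar>k (v i)\<bar> / g (v' i))"
    define f where "f x = M * g (x - k x *\<^sub>R a) + k x" for x
    have "linear f"
    proof (rule linearI)
      fix x y
      have "x + y - k (x + y) *\<^sub>R a = (x - k x *\<^sub>R a) + (y - k y *\<^sub>R a)"
        by (simp add: linear_add[OF k(1)] scaleR_add_left)
      then show "f (x + y) = f x + f y"
        unfolding f_def by (simp only: linear_add[OF g(1)] linear_add[OF k(1)]) (simp add: distrib_left)
    next
      fix c x
      have "c *\<^sub>R x - k (c *\<^sub>R x) *\<^sub>R a = c *\<^sub>R (x - k x *\<^sub>R a)"
        by (simp add: linear_scale[OF k(1)] scaleR_diff_right)
      then show "f (c *\<^sub>R x) = c *\<^sub>R f x"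
        unfolding f_def by (simp only: linear_scale[OF g(1)] linear_scale[OF k(1)]) (simp add: distrib_left)
    qed
    moreover have "0 < f (v i)" if "i \<in> I" for i
    proof -
      have gi: "0 < g (v' i)" using g that by auto
      have "\<bar>k (v i)\<bar> / g (v' i) \<le> (\<Sum>i\<in>I. \<bar>k (v i)\<bar> / g (v' i))"
        using that insert.hyps g by (intro member_le_sum) (auto intro!: divide_nonneg_pos)
      then have "\<bar>k (v i)\<bar> / g (v' i) < M" unfolding M_def by simp
      then have "\<bar>k (v i)\<bar> < M * g (v' i)" using gi by (simp add: field_simps)
      then show ?thesis unfolding f_def v'_def[symmetric] by linarith
    qed
    moreover have "0 < f (v j)"
      using k linear_0[OF g(1)] by (simp add: f_def a_def[symmetric])
    ultimately show ?thesis by auto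
  next
    case False
    then obtain c where c: "\<forall>i\<in>I. 0 \<le> c i" "(\<Sum>i\<in>I. c i *\<^sub>R v' i) = 0" "\<not> (\<forall>i\<in>I. c i = 0)"
      by blast
    \<comment> \<open>A nontrivial combination that projects to zero equals
      \<open>t *\<^sub>R a\<close>. Positive independence excludes \<open>t \<le> 0\<close>, so
      \<open>a\<close> lies in the cone of the other vectors, and any functional positive on them is
      positive on \<open>a\<close>.\<close>
    define t where "t = (\<Sum>i\<in>I. c i * k (v i))"
    have eq: "(\<Sum>i\<in>I. c i *\<^sub>R v i) = t *\<^sub>R a"
      using c(2) by (simp add: v'_def t_def scaleR_diff_right sum_subtractf scaleR_sum_left)
    have "t > 0"
    proof (rule ccontr)
      assume "\<not> t > 0"
      define d where "d i = (if i = j then - t else c i)" for i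
      have "(\<Sum>i\<in>I. d i *\<^sub>R v i) = (\<Sum>i\<in>I. c i *\<^sub>R v i)"
        using insert.hyps by (intro sum.cong) (auto simp: d_def)
      then have "(\<Sum>i\<in>insert j I. d i *\<^sub>R v i) = 0"
        unfolding sum_ins by (simp add: eq) (simp add: d_def)
      moreover have "\<forall>i\<in>insert j I. 0 \<le> d i" using c(1) \<open>\<not> t > 0\<close> by (simp add: d_def)
      ultimately have d0: "\<forall>i\<in>insert j I. d i = 0" by (intro insert.prems)
      have "c i = 0" if "i \<in> I" for i
        using bspec[OF d0, of i] that insert.hyps by (auto simp: d_def split: if_splits)
      then show False using c(3) by blast
    qed
    have "\<exists>f::'a \<Rightarrow> real. linear f \<and> (\<forall>i\<in>I. 0 < f (v i))"
    proof (rule insert.IH)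
      fix d assume d: "\<forall>i\<in>I. 0 \<le> d i" "(\<Sum>i\<in>I. d i *\<^sub>R v i) = 0"
      have "(\<Sum>i\<in>insert j I. (if i = j then 0 else d i) *\<^sub>R v i) = (\<Sum>i\<in>I. d i *\<^sub>R v i)"
        unfolding sum_ins using insert.hyps by (auto intro!: sum.cong)
      then have "\<forall>i\<in>insert j I. (if i = j then 0 else d i) = 0"
        using d by (intro insert.prems) auto
      then show "\<forall>i\<in>I. d i = 0" using insert.hyps by (metis insertCI)
    qed
    then obtain f :: "'a \<Rightarrow> real" where f: "linear f" "\<forall>i\<in>I. 0 < f (v i)" by blast
    have "t * f a = (\<Sum>i\<in>I. c i * f (v i))"
      using arg_cong[OF eq, of f] by (simp add: linear_sum[OF f(1)] linear_scale[OF f(1)])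
    moreover have "0 < (\<Sum>i\<in>I. c i * f (v i))"
    proof -
      obtain i where i: "i \<in> I" "c i \<noteq> 0" using c(3) by blast
      show ?thesis
        using c(1) f(2) i insert.hyps
        by (intro sum_pos2[of _ i]) (auto simp: less_le)
    qed
    ultimately have "0 < f a" using \<open>t > 0\<close> by (metis zero_less_mult_pos)
    then show ?thesis using f by (auto simp: a_def)
  qed
qed

lemma positively_independentD:
  assumes "positively_independent X" "finite X" "\<And>x. x \<in> X \<Longrightarrow> 0 \<le> c x"
    "(\<Sum>x\<in>X. c x *\<^sub>R x) = 0" "x \<in> X"
  shows "c x = 0"
  using assms(1)[unfolded positively_independent_def, rule_format, of X c x] assms(2-) by simp

lemma positive_functional:
  fixes X :: "'a::real_vector set"
  assumes "finite X" "positively_independent X"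
  obtains f :: "'a \<Rightarrow> real" where "linear f" "\<And>x. x \<in> X \<Longrightarrow> 0 < f x"
proof -
  have "\<exists>f::'a \<Rightarrow> real. linear f \<and> (\<forall>x\<in>X. 0 < f x)"
    using positively_independentD[OF assms(2,1)]
    by (intro positive_functional_family assms) auto
  then show thesis using that by auto
qed

context
  fixes X :: "'a::real_vector set" and f :: "'a \<Rightarrow> real"
  assumes fin: "finite X" and f: "linear f" and f_pos: "\<And>x. x \<in> X \<Longrightarrow> 0 < f x"
begin

lemma functional_nonneg:
  assumes "y \<in> nonneg_span X" shows "0 \<le> f y"
proof -
  obtain c where c: "\<And>x. x \<in> X \<Longrightarrow> 0 \<le> c x" "y = (\<Sum>x\<in>X. c x *\<^sub>R x)"
    using nonneg_spanE[OF fin assms] by blast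
  then have "0 \<le> (\<Sum>x\<in>X. c x * f x)"
    using f_pos by (intro sum_nonneg mult_nonneg_nonneg) (auto intro: less_imp_le)
  then show ?thesis by (simp add: c(2) linear_sum[OF f] linear_scale[OF f])
qed

lemma functional_pos:
  assumes "y \<in> nonneg_span X" "y \<noteq> 0" shows "0 < f y"
proof -
  obtain c where c: "\<And>x. x \<in> X \<Longrightarrow> 0 \<le> c x" "y = (\<Sum>x\<in>X. c x *\<^sub>R x)"
    using nonneg_spanE[OF fin assms(1)] by blast
  have "\<exists>x\<in>X. c x \<noteq> 0"
  proof (rule ccontr)
    assume "\<not> (\<exists>x\<in>X. c x \<noteq> 0)"
    then show False using assms(2) c(2) by simp
  qed
  then obtain x where x: "x \<in> X" "c x \<noteq> 0" by blast
  have "0 < (\<Sum>x\<in>X. c x * f x)"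
  proof (rule sum_pos2[OF fin x(1)])
    show "0 < c x * f x" using c(1)[OF x(1)] x(2) f_pos[OF x(1)] by simp
    show "0 \<le> c z * f z" if "z \<in> X" for z using c(1)[OF that] f_pos[OF that] by simp
  qed
  then show ?thesis by (simp add: c(2) linear_sum[OF f] linear_scale[OF f])
qed

lemma nonneg_span_pointed:
  assumes "y \<in> nonneg_span X" "- y \<in> nonneg_span X" shows "y = 0"
proof (rule ccontr)
  assume "y \<noteq> 0"
  then have "0 < f y" by (rule functional_pos[OF assms(1)])
  then show False using functional_nonneg[OF assms(2)] linear_neg[OF f, of y] by simp
qed

end

section \<open>Compactness and closedness of finitely generated cones\<close>

lemma bounded_family_subsequence:
  fixes c :: "nat \<Rightarrow> 'a \<Rightarrow> real"
  assumes "finite X" "\<And>n x. x \<in> X \<Longrightarrow> c n x \<in> {0..M x}"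
  shows "\<exists>r l. strict_mono r \<and> (\<forall>x\<in>X. (\<lambda>n. c (r n) x) \<longlonglongrightarrow> l x)"
  using assms
proof (induction X rule: finite_induct)
  case empty
  show ?case by (intro exI[of _ id]) (auto simp: strict_mono_def)
next
  case (insert a X)
  then obtain r l where r: "strict_mono r" "\<forall>x\<in>X. (\<lambda>n. c (r n) x) \<longlonglongrightarrow> l x" by blast
  have "\<forall>n. c (r n) a \<in> {0..M a}" using insert.prems by auto
  then obtain k q where k: "strict_mono q" "((\<lambda>n. c (r n) a) \<circ> q) \<longlonglongrightarrow> k"
    using compact_Icc[of 0 "M a"] unfolding compact_def by meson
  have "(\<lambda>n. c ((r \<circ> q) n) x) \<longlonglongrightarrow> (if x = a then k else l x)" if "x \<in> insert a X" for x
    using LIMSEQ_subseq_LIMSEQ[OF _ k(1)] k(2) r(2) that by (auto simp: o_def)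
  then show ?case using strict_mono_o[OF r(1) k(1)]
    by (intro exI[of _ "r \<circ> q"] exI[of _ "\<lambda>x. if x = a then k else l x"]) blast
qed

lemma tendsto_functional_sum:
  fixes l :: "'a::real_vector \<Rightarrow> real"
  assumes "linear l" "\<And>x. x \<in> X \<Longrightarrow> (\<lambda>n. C n x) \<longlonglongrightarrow> c x"
  shows "(\<lambda>n. l (\<Sum>x\<in>X. C n x *\<^sub>R x)) \<longlonglongrightarrow> l (\<Sum>x\<in>X. c x *\<^sub>R x)"
proof -
  have "(\<lambda>n. \<Sum>x\<in>X. C n x *\<^sub>R l x) \<longlonglongrightarrow> (\<Sum>x\<in>X. c x *\<^sub>R l x)"
    by (intro tendsto_sum tendsto_scaleR assms(2) tendsto_const)
  then show ?thesis by (simp only: linear_sum[OF assms(1)] linear_scale[OF assms(1)])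
qed

text \<open>The summands of \<open>f (b n)\<close> are nonnegative, so the coefficient at
  \<open>x\<close> is at most \<open>M / f x\<close>. The coefficients \<open>C\<close> are a
  choice, since \<open>X\<close> may be linearly dependent.\<close>

lemma nonneg_span_compact:
  fixes f :: "'a::real_vector \<Rightarrow> real"
  assumes fin: "finite X" and f: "linear f" and f_pos: "\<And>x. x \<in> X \<Longrightarrow> 0 < f x"
    and b: "\<And>n. b n \<in> nonneg_span X" and bd: "\<And>n. f (b n) \<le> M"
  obtains r C c where "strict_mono (r :: nat \<Rightarrow> nat)" "\<And>x. x \<in> X \<Longrightarrow> 0 \<le> c x"
    "\<And>n. b (r n) = (\<Sum>x\<in>X. C n x *\<^sub>R x)" "\<And>x. x \<in> X \<Longrightarrow> (\<lambda>n. C n x) \<longlonglongrightarrow> c x"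
proof -
  have "\<forall>n. \<exists>c. (\<forall>x\<in>X. 0 \<le> c x) \<and> b n = (\<Sum>x\<in>X. c x *\<^sub>R x)"
    using nonneg_spanE[OF fin b] by metis
  then obtain C where C: "\<And>n x. x \<in> X \<Longrightarrow> 0 \<le> C n x" "\<And>n. b n = (\<Sum>x\<in>X. C n x *\<^sub>R x)"
    by metis
  have "C n x \<in> {0..M / f x}" if x: "x \<in> X" for n x
  proof -
    have "C n x * f x \<le> (\<Sum>x\<in>X. C n x * f x)"
      using C f_pos x fin by (intro member_le_sum) (auto simp: less_imp_le)
    also have "\<dots> = f (b n)" by (simp add: C(2) linear_sum[OF f] linear_scale[OF f])
    finally show ?thesis using bd[of n] C(1)[OF x] f_pos[OF x] by (simp add: field_simps)
  qed
  then obtain r l where r: "strict_mono r" "\<forall>x\<in>X. (\<lambda>n. C (r n) x) \<longlonglongrightarrow> l x"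
    using bounded_family_subsequence[OF fin, of C "\<lambda>x. M / f x"] by blast
  show ?thesis
  proof (rule that[of r l "\<lambda>n. C (r n)"])
    fix x assume "x \<in> X"
    then show "0 \<le> l x" using r(2) C(1) by (auto intro: LIMSEQ_le_const)
  qed (use r C(2) in auto)
qed

text \<open>Along a subsequence the coefficients converge and define a point of the cone. It equals
  \<open>x\<close> because linear functionals separate points.\<close>

lemma nonneg_span_closed:
  fixes X :: "'a::real_vector set"
  assumes fin: "finite X" and ind: "positively_independent X"
    and b: "\<And>n. b n \<in> nonneg_span X"
    and lim: "\<And>l::'a \<Rightarrow> real. linear l \<Longrightarrow> (\<lambda>n. l (b n)) \<longlonglongrightarrow> l x"
  shows "x \<in> nonneg_span X"
proof -
  obtain f :: "'a \<Rightarrow> real" where f: "linear f" "\<And>x. x \<in> X \<Longrightarrow> 0 < f x"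
    by (rule positive_functional[OF fin ind]) blast
  have "Bseq (\<lambda>n. f (b n))" using lim[OF f(1)] by (intro convergent_imp_Bseq convergentI)
  then obtain M where M: "\<And>n. norm (f (b n)) \<le> M" unfolding Bseq_def by blast
  have bM: "f (b n) \<le> M" for n using M[of n] by simp
  obtain r C c where r: "strict_mono (r :: nat \<Rightarrow> nat)" "\<And>x. x \<in> X \<Longrightarrow> 0 \<le> c x"
    "\<And>n. b (r n) = (\<Sum>x\<in>X. C n x *\<^sub>R x)" "\<And>x. x \<in> X \<Longrightarrow> (\<lambda>n. C n x) \<longlonglongrightarrow> c x"
    by (rule nonneg_span_compact[of X f b M, OF fin f b bM]) (assumption, blast)
  let ?y = "\<Sum>x\<in>X. c x *\<^sub>R x"
  have eq: "l ?y = l x" if "linear l" for l :: "'a \<Rightarrow> real"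
  proof (rule LIMSEQ_unique)
    show "(\<lambda>n. l (b (r n))) \<longlonglongrightarrow> l ?y"
      unfolding r(3) by (rule tendsto_functional_sum[OF that r(4)])
    show "(\<lambda>n. l (b (r n))) \<longlonglongrightarrow> l x"
      using LIMSEQ_subseq_LIMSEQ[OF lim[OF that] r(1)] by (simp add: o_def)
  qed
  have "?y = x"
  proof (rule ccontr)
    assume "?y \<noteq> x"
    then obtain k :: "'a \<Rightarrow> real" where "linear k" "k (?y - x) = 1"
      using exists_functional[of "?y - x"] by auto
    then show False using eq[of k] by (simp add: linear_diff)
  qed
  moreover have "?y \<in> nonneg_span X" by (rule nonneg_spanI[OF fin r(2)])
  ultimately show ?thesis by simp
qed

section \<open>Bases of a root system\<close>

text \<open>\<open>cr \<beta>\<close> stands for the pairing with the coroot of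
  \<open>\<beta>\<close>. No base is fixed, so that two bases can be compared within one
  instance.\<close>

locale root_system =
  fixes R :: "'v::real_vector set" and cr :: "'v \<Rightarrow> 'v \<Rightarrow> real" and W :: "('v \<Rightarrow> 'v) set"
  assumes cr_linear: "\<beta> \<in> R \<Longrightarrow> linear (cr \<beta>)"
    and cr_self: "\<beta> \<in> R \<Longrightarrow> cr \<beta> \<beta> = 2"
    and refl_W: "\<beta> \<in> R \<Longrightarrow> (\<lambda>v. v - cr \<beta> v *\<^sub>R \<beta>) \<in> W"
    and id_W: "id \<in> W"
    and comp_W: "w \<in> W \<Longrightarrow> u \<in> W \<Longrightarrow> w \<circ> u \<in> W"
    and linear_W: "w \<in> W \<Longrightarrow> linear w"
    and inv_W: "w \<in> W \<Longrightarrow> \<exists>u\<in>W. u \<circ> w = id \<and> w \<circ> u = id"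
    and W_R: "w \<in> W \<Longrightarrow> \<beta> \<in> R \<Longrightarrow> w \<beta> \<in> R"
    and cr_equivariant: "w \<in> W \<Longrightarrow> \<beta> \<in> R \<Longrightarrow> cr (w \<beta>) (w v) = cr \<beta> v"
begin

definition rf :: "'v \<Rightarrow> 'v \<Rightarrow> 'v" where
  "rf \<beta> v = v - cr \<beta> v *\<^sub>R \<beta>"

text \<open>The last conjunct says that the simple reflections generate \<open>W\<close>; left
  multiplication is enough because they are involutions.\<close>

definition root_base :: "'v set \<Rightarrow> bool" where
  "root_base D \<longleftrightarrow> finite D \<and> D \<subseteq> R \<and> positively_independent D \<and>
     (\<forall>\<beta>\<in>R. \<beta> \<in> nonneg_span D \<or> - \<beta> \<in> nonneg_span D) \<and>
     (\<forall>\<alpha>\<in>D. \<forall>\<beta>\<in>D. \<alpha> \<noteq> \<beta> \<longrightarrow> cr \<beta> \<alpha> \<le> 0 \<and> (cr \<beta> \<alpha> = 0 \<longrightarrow> cr \<alpha> \<beta> = 0)) \<and>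
     (\<forall>T. id \<in> T \<longrightarrow> (\<forall>\<alpha>\<in>D. \<forall>w\<in>T. rf \<alpha> \<circ> w \<in> T) \<longrightarrow> W \<subseteq> T)"

text \<open>Rays spanned by roots are represented by all their points, since proportional roots need not
  agree up to sign.\<close>

definition rays :: "'v set" where
  "rays = {b. \<exists>k>0. k *\<^sub>R b \<in> R}"

lemma rf_W: "\<beta> \<in> R \<Longrightarrow> rf \<beta> \<in> W"
  using refl_W by (simp add: rf_def[abs_def])

lemma rf_self: "\<beta> \<in> R \<Longrightarrow> rf \<beta> \<beta> = - \<beta>"
  by (simp add: rf_def cr_self scaleR_2)

lemma rf_rf: "\<beta> \<in> R \<Longrightarrow> rf \<beta> (rf \<beta> v) = v"
  by (simp add: rf_def linear_diff[OF cr_linear] linear_scale[OF cr_linear] cr_self)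

lemma zero_notin_R: "0 \<notin> R"
  using cr_self[of 0] linear_0[OF cr_linear[of 0]] by auto

lemma uminus_R:
  assumes "\<beta> \<in> R" shows "- \<beta> \<in> R" "cr (- \<beta>) v = - cr \<beta> v"
proof -
  show "- \<beta> \<in> R" using W_R[OF rf_W assms] rf_self assms by metis
  have "cr (- \<beta>) v = cr (rf \<beta> \<beta>) (rf \<beta> (rf \<beta> v))" using assms by (simp add: rf_self rf_rf)
  also have "\<dots> = cr \<beta> (rf \<beta> v)" by (rule cr_equivariant[OF rf_W assms]) fact
  also have "\<dots> = - cr \<beta> v"
    using assms by (simp add: rf_def linear_diff[OF cr_linear] linear_scale[OF cr_linear] cr_self)
  finally show "cr (- \<beta>) v = - cr \<beta> v" .
qed

lemma rf_uminus: "\<beta> \<in> R \<Longrightarrow> rf (- \<beta>) = rf \<beta>"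
  by (auto simp: rf_def uminus_R)

lemma W_inj:
  assumes "w \<in> W" "w x = w y" shows "x = y"
proof -
  obtain u where "u \<circ> w = id" using inv_W[OF assms(1)] by blast
  then have "u (w v) = v" for v by (metis comp_apply id_apply)
  then show ?thesis using assms(2) by metis
qed

lemma raysI: "\<beta> \<in> R \<Longrightarrow> k > 0 \<Longrightarrow> k *\<^sub>R \<beta> \<in> rays"
  unfolding rays_def by (intro CollectI exI[of _ "inverse k"]) auto

lemma zero_notin_rays: "b \<in> rays \<Longrightarrow> b \<noteq> 0"
  using zero_notin_R unfolding rays_def by auto

lemma W_rays:
  assumes "w \<in> W" "b \<in> rays" shows "w b \<in> rays"
proof -
  obtain k where k: "k > 0" "k *\<^sub>R b \<in> R" using assms(2) unfolding rays_def by blast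
  have "k *\<^sub>R w b \<in> R" using W_R[OF assms(1) k(2)] by (simp add: linear_scale[OF linear_W[OF assms(1)]])
  then show ?thesis using k(1) unfolding rays_def by blast
qed

lemma scale_rays:
  assumes "b \<in> rays" "t > 0" shows "t *\<^sub>R b \<in> rays"
proof -
  obtain k where k: "k > 0" "k *\<^sub>R b \<in> R" using assms(1) unfolding rays_def by blast
  then have "t *\<^sub>R b = (t / k) *\<^sub>R (k *\<^sub>R b)" by simp
  then show ?thesis using raysI[OF k(2), of "t / k"] k assms by simp
qed

section \<open>Simple roots as extremal rays, and sign changes of rays\<close>

context
  fixes D assumes base: "root_base D"
begin

lemma base_fin: "finite D"
  and base_R: "\<alpha> \<in> D \<Longrightarrow> \<alpha> \<in> R"
  and base_ind: "positively_independent D"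
  and base_pm: "\<beta> \<in> R \<Longrightarrow> \<beta> \<in> nonneg_span D \<or> - \<beta> \<in> nonneg_span D"
  and base_le: "\<alpha> \<in> D \<Longrightarrow> \<beta> \<in> D \<Longrightarrow> \<alpha> \<noteq> \<beta> \<Longrightarrow> cr \<beta> \<alpha> \<le> 0"
  and base_sym: "\<alpha> \<in> D \<Longrightarrow> \<beta> \<in> D \<Longrightarrow> \<alpha> \<noteq> \<beta> \<Longrightarrow> cr \<beta> \<alpha> = 0 \<Longrightarrow> cr \<alpha> \<beta> = 0"
  using base unfolding root_base_def by auto

lemma base_rf_W: "\<alpha> \<in> D \<Longrightarrow> rf \<alpha> \<in> W"
  by (rule rf_W[OF base_R])

lemma base_induct [consumes 1, case_names id reflection]:
  assumes "w \<in> W" "P id" "\<And>\<alpha> w. \<alpha> \<in> D \<Longrightarrow> w \<in> W \<Longrightarrow> P w \<Longrightarrow> P (rf \<alpha> \<circ> w)"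
  shows "P w"
proof -
  have gen: "\<forall>T. id \<in> T \<longrightarrow> (\<forall>\<alpha>\<in>D. \<forall>w\<in>T. rf \<alpha> \<circ> w \<in> T) \<longrightarrow> W \<subseteq> T"
    using base unfolding root_base_def by (elim conjE)
  have "rf \<alpha> \<circ> w \<in> {w \<in> W. P w}" if "\<alpha> \<in> D" "w \<in> {w \<in> W. P w}" for \<alpha> w
    using that assms(3) comp_W[OF base_rf_W] by simp
  then have "W \<subseteq> {w \<in> W. P w}"
    using id_W assms(2) by (intro gen[rule_format]) auto
  then show ?thesis using assms(1) by blast
qed

lemma rays_pm:
  assumes "b \<in> rays" shows "b \<in> nonneg_span D \<or> - b \<in> nonneg_span D"
proof -
  obtain k where k: "k > 0" "k *\<^sub>R b \<in> R" using assms unfolding rays_def by blast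
  then show ?thesis
    using base_pm[OF k(2)] nonneg_span_scale_iff[OF base_fin k(1), of b]
      nonneg_span_scale_iff[OF base_fin k(1), of "- b"] by auto
qed

lemma base_pointed:
  assumes "y \<in> nonneg_span D" "- y \<in> nonneg_span D" shows "y = 0"
proof -
  obtain f :: "'v \<Rightarrow> real" where "linear f" "\<And>x. x \<in> D \<Longrightarrow> 0 < f x"
    by (rule positive_functional[OF base_fin base_ind]) blast
  from nonneg_span_pointed[OF base_fin this assms] show ?thesis .
qed

text \<open>Collecting terms leaves a nonnegative combination of the other simple roots equal to
  \<open>?r *\<^sub>R \<alpha>\<close>. The pairings force \<open>?r \<le> 0\<close>, and positive
  independence then kills every coefficient away from \<open>\<alpha>\<close>.\<close>

lemma base_extremal:
  assumes \<alpha>: "\<alpha> \<in> D" and u: "u \<in> nonneg_span D" and v: "v \<in> nonneg_span D" and eq: "u + v = k *\<^sub>R \<alpha>"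
  obtains t where "t \<ge> 0" "u = t *\<^sub>R \<alpha>"
proof -
  obtain c where c: "\<And>x. x \<in> D \<Longrightarrow> 0 \<le> c x" "u = (\<Sum>x\<in>D. c x *\<^sub>R x)"
    using nonneg_spanE[OF base_fin u] by blast
  obtain d where d: "\<And>x. x \<in> D \<Longrightarrow> 0 \<le> d x" "v = (\<Sum>x\<in>D. d x *\<^sub>R x)"
    using nonneg_spanE[OF base_fin v] by blast
  let ?r = "k - c \<alpha> - d \<alpha>"
  have split: "(\<Sum>x\<in>D. g x *\<^sub>R x) = g \<alpha> *\<^sub>R \<alpha> + (\<Sum>x\<in>D - {\<alpha>}. g x *\<^sub>R x)" for g
    by (rule sum.remove[OF base_fin \<alpha>])
  have eq': "(\<Sum>x\<in>D - {\<alpha>}. (c x + d x) *\<^sub>R x) = ?r *\<^sub>R \<alpha>"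
    using eq unfolding c(2) d(2) split[of c] split[of d]
    by (simp add: scaleR_add_left scaleR_diff_left sum.distrib algebra_simps)
  have "?r \<le> 0"
  proof (rule ccontr)
    assume "\<not> ?r \<le> 0"
    \<comment> \<open>The coroot of \<open>\<alpha>\<close> is 2 on \<open>\<alpha>\<close> and
      nonpositive on the other simple roots.\<close>
    have "2 * ?r = cr \<alpha> (?r *\<^sub>R \<alpha>)"
      using \<alpha> by (simp add: linear_scale[OF cr_linear[OF base_R]] cr_self base_R)
    also have "\<dots> = (\<Sum>x\<in>D - {\<alpha>}. (c x + d x) * cr \<alpha> x)"
      unfolding eq'[symmetric] using \<alpha>
      by (simp add: linear_sum[OF cr_linear[OF base_R]] linear_scale[OF cr_linear[OF base_R]])
    also have "\<dots> \<le> 0"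
      using c(1) d(1) base_le[OF _ \<alpha>] by (intro sum_nonpos mult_nonneg_nonpos) auto
    finally show False using \<open>\<not> ?r \<le> 0\<close> by simp
  qed
  define e where "e x = (if x = \<alpha> then - ?r else c x + d x)" for x
  have "(\<Sum>x\<in>D - {\<alpha>}. e x *\<^sub>R x) = (\<Sum>x\<in>D - {\<alpha>}. (c x + d x) *\<^sub>R x)"
    by (rule sum.cong) (auto simp: e_def)
  then have "(\<Sum>x\<in>D. e x *\<^sub>R x) = 0" unfolding split eq' by (simp add: e_def flip: scaleR_add_left)
  moreover have "0 \<le> e x" if "x \<in> D" for x using c(1)[OF that] d(1)[OF that] \<open>?r \<le> 0\<close> by (simp add: e_def)
  ultimately have e0: "e x = 0" if "x \<in> D" for x
    using positively_independentD[OF base_ind base_fin, of e x] that by blast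
  have "c x = 0" if "x \<in> D - {\<alpha>}" for x
    using e0[of x] c(1)[of x] d(1)[of x] that by (auto simp: e_def)
  then have "u = c \<alpha> *\<^sub>R \<alpha>" unfolding c(2) split by (simp add: sum.neutral)
  then show thesis using that c(1)[OF \<alpha>] by blast
qed

lemma base_proportional:
  assumes "\<alpha> \<in> D" "\<beta> \<in> D" "\<beta> = t *\<^sub>R \<alpha>" "t \<ge> 0" shows "\<beta> = \<alpha>"
proof (rule ccontr)
  assume "\<beta> \<noteq> \<alpha>"
  then have "cr \<alpha> \<beta> \<le> 0" using base_le assms by blast
  then have "t \<le> 0"
    using assms by (simp add: linear_scale[OF cr_linear[OF base_R]] cr_self base_R)
  then show False using assms zero_notin_R base_R by force
qed

text \<open>If \<open>rf \<alpha> b\<close> is negative, then \<open>b\<close> and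
  \<open>- rf \<alpha> b\<close> are points of the cone whose sum is a multiple of
  \<open>\<alpha>\<close>, so extremality applies.\<close>

lemma simple_reflection_permutes_rays:
  assumes \<alpha>: "\<alpha> \<in> D" and b: "b \<in> rays" "b \<in> nonneg_span D" "rf \<alpha> b \<notin> nonneg_span D"
  obtains t where "t > 0" "b = t *\<^sub>R \<alpha>"
proof -
  have "- rf \<alpha> b \<in> nonneg_span D"
    using rays_pm[OF W_rays[OF base_rf_W[OF \<alpha>] b(1)]] b(3) by blast
  moreover have "b + - rf \<alpha> b = cr \<alpha> b *\<^sub>R \<alpha>" by (simp add: rf_def)
  ultimately obtain t where "t \<ge> 0" "b = t *\<^sub>R \<alpha>" using base_extremal[OF \<alpha> b(2)] by blast
  moreover from this have "t \<noteq> 0" using zero_notin_rays[OF b(1)] by auto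
  ultimately have "t > 0" "b = t *\<^sub>R \<alpha>" by auto
  then show thesis by (rule that)
qed

text \<open>A further factor \<open>rf \<alpha>\<close> newly makes negative only what
  \<open>w\<close> sends to the ray of \<open>\<alpha>\<close>. As \<open>w\<close> is injective and
  \<open>Q\<close> meets each ray at most once, this adds at most one point.\<close>

lemma finite_rays_made_negative:
  assumes "w \<in> W" "Q \<subseteq> rays" and reduced: "\<And>b k. b \<in> Q \<Longrightarrow> k > 0 \<Longrightarrow> k *\<^sub>R b \<in> Q \<Longrightarrow> k = 1"
  shows "finite {b \<in> Q. b \<in> nonneg_span D \<and> w b \<notin> nonneg_span D}"
  using assms(1)
proof (induction rule: base_induct)
  case id
  show ?case by simp
next
  case (reflection \<alpha> w)
  let ?E = "{b \<in> Q. \<exists>t>0. w b = t *\<^sub>R \<alpha>}"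
  have eq: "b1 = b2" if b1: "b1 \<in> ?E" and b2: "b2 \<in> ?E" for b1 b2
  proof -
    obtain t1 where t1: "t1 > 0" "w b1 = t1 *\<^sub>R \<alpha>" using b1 by blast
    obtain t2 where t2: "t2 > 0" "w b2 = t2 *\<^sub>R \<alpha>" using b2 by blast
    have "w ((t2 / t1) *\<^sub>R b1) = w b2"
      using t1 t2 by (simp add: linear_scale[OF linear_W[OF reflection(2)]])
    then have *: "(t2 / t1) *\<^sub>R b1 = b2" by (rule W_inj[OF reflection(2)])
    then have "t2 / t1 = 1" using reduced[of b1 "t2 / t1"] b1 b2 t1 t2 by simp
    then show ?thesis using * by simp
  qed
  have "finite ?E"
  proof (cases "?E = {}")
    case False
    then obtain b where "b \<in> ?E" by blast
    then have "?E \<subseteq> {b}" using eq by blast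
    then show ?thesis by (rule finite_subset) simp
  next
    case True
    then show ?thesis by (simp only: finite.emptyI)
  qed
  moreover have "{b \<in> Q. b \<in> nonneg_span D \<and> (rf \<alpha> \<circ> w) b \<notin> nonneg_span D} \<subseteq>
    {b \<in> Q. b \<in> nonneg_span D \<and> w b \<notin> nonneg_span D} \<union> ?E"
  proof
    fix b assume b: "b \<in> {b \<in> Q. b \<in> nonneg_span D \<and> (rf \<alpha> \<circ> w) b \<notin> nonneg_span D}"
    then have "w b \<in> rays" using assms(2) W_rays[OF reflection(2)] by blast
    show "b \<in> {b \<in> Q. b \<in> nonneg_span D \<and> w b \<notin> nonneg_span D} \<union> ?E"
    proof (cases "w b \<in> nonneg_span D")
      case True
      obtain t where "t > 0" "w b = t *\<^sub>R \<alpha>"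
        using simple_reflection_permutes_rays[OF reflection(1) \<open>w b \<in> rays\<close> True] b by auto
      then show ?thesis using b by blast
    qed (use b in blast)
  qed
  ultimately show ?case using reflection(3) by (elim finite_subset) simp
qed

lemma root_base_uminus: "root_base (uminus ` D)"
  unfolding root_base_def
proof (intro conjI ballI allI impI)
  show "finite (uminus ` D)" using base_fin by simp
  show "uminus ` D \<subseteq> R" using base_R uminus_R by auto
  show "positively_independent (uminus ` D)"
    unfolding positively_independent_def
  proof (intro allI impI ballI)
    fix F c x
    assume F: "finite F \<and> F \<subseteq> uminus ` D \<and> (\<forall>x\<in>F. 0 \<le> c x) \<and> (\<Sum>x\<in>F. c x *\<^sub>R x) = 0" and x: "x \<in> F"
    have "(\<Sum>x\<in>uminus ` F. c (- x) *\<^sub>R x) = (\<Sum>x\<in>F. c x *\<^sub>R (- x))"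
      by (subst sum.reindex) auto
    also have "\<dots> = 0" using F by (simp add: sum_negf)
    finally have "(\<Sum>x\<in>uminus ` F. c (- x) *\<^sub>R x) = 0" .
    moreover have "finite (uminus ` F)" "uminus ` F \<subseteq> D" "\<forall>x\<in>uminus ` F. 0 \<le> c (- x)" using F by auto
    ultimately have "\<forall>x\<in>uminus ` F. c (- x) = 0"
      using base_ind[unfolded positively_independent_def, rule_format, of "uminus ` F" "\<lambda>x. c (- x)"]
      by blast
    then show "c x = 0" using x by simp
  qed
next
  fix \<beta> assume "\<beta> \<in> R"
  then show "\<beta> \<in> nonneg_span (uminus ` D) \<or> - \<beta> \<in> nonneg_span (uminus ` D)"
    using base_pm[of \<beta>] nonneg_span_uminus[OF base_fin] by auto
next
  fix \<alpha> \<beta> assume ab: "\<alpha> \<in> uminus ` D" "\<beta> \<in> uminus ` D" "\<alpha> \<noteq> \<beta>"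
  then obtain a b where eq: "a \<in> D" "b \<in> D" "\<alpha> = - a" "\<beta> = - b" by auto
  then have cr_eq: "cr \<beta> \<alpha> = cr b a" "cr \<alpha> \<beta> = cr a b"
    by (simp_all add: uminus_R linear_neg[OF cr_linear] base_R)
  show "cr \<beta> \<alpha> \<le> 0" using base_le[of a b] eq ab cr_eq by auto
  show "cr \<alpha> \<beta> = 0" if "cr \<beta> \<alpha> = 0" using base_sym[of a b] eq ab cr_eq that by auto
next
  fix T assume T: "id \<in> T" "\<forall>\<alpha>\<in>uminus ` D. \<forall>w\<in>T. rf \<alpha> \<circ> w \<in> T"
  then have "\<forall>\<alpha>\<in>D. \<forall>w\<in>T. rf \<alpha> \<circ> w \<in> T" using rf_uminus base_R by force
  moreover have "\<forall>T. id \<in> T \<longrightarrow> (\<forall>\<alpha>\<in>D. \<forall>w\<in>T. rf \<alpha> \<circ> w \<in> T) \<longrightarrow> W \<subseteq> T"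
    using base unfolding root_base_def by (elim conjE)
  ultimately show "W \<subseteq> T" using T(1) by simp
qed

end

end

section \<open>Comparing two bases\<close>

context root_system
begin

text \<open>A relative inversion set. The level \<open>f b = 1\<close> selects one point per ray, so
  its cardinality counts rays and acts as a length in the descent.\<close>

definition neg_rays :: "('v \<Rightarrow> real) \<Rightarrow> 'v set \<Rightarrow> 'v set \<Rightarrow> ('v \<Rightarrow> 'v) \<Rightarrow> 'v set" where
  "neg_rays f D E w = {b \<in> rays. b \<in> nonneg_span D \<and> f b = 1 \<and> - w b \<in> nonneg_span E}"

text \<open>Connectedness of the Coxeter graph, in terms of sets closed under adjacency: it is
  applied to the simple roots lying in an invariant subspace and to the zero set of a family of
  coefficients.\<close>

definition connected_base :: "'v set \<Rightarrow> bool" where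
  "connected_base D \<longleftrightarrow>
     (\<forall>A\<subseteq>D. A \<noteq> {} \<longrightarrow> (\<forall>\<alpha>\<in>A. \<forall>\<beta>\<in>D. \<alpha> \<noteq> \<beta> \<longrightarrow> cr \<beta> \<alpha> \<noteq> 0 \<longrightarrow> \<beta> \<in> A) \<longrightarrow> A = D)"

section \<open>Limits of rays and their orbits\<close>

text \<open>\<open>w\<close> makes only finitely many of the distinct rays \<open>b n\<close>
  negative, so a tail of \<open>w (b n)\<close> stays in the cone, which is closed.\<close>

lemma limit_of_rays_invariant:
  assumes D: "root_base D" and w: "w \<in> W"
    and b: "inj b" "\<And>n. b n \<in> rays" "\<And>n. b n \<in> nonneg_span D"
    and reduced: "\<And>n m k. k > 0 \<Longrightarrow> k *\<^sub>R b n = b m \<Longrightarrow> k = 1"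
    and lim: "\<And>l::'v \<Rightarrow> real. linear l \<Longrightarrow> (\<lambda>n. l (b n)) \<longlonglongrightarrow> l x"
  shows "w x \<in> nonneg_span D"
proof -
  let ?bad = "{v \<in> range b. v \<in> nonneg_span D \<and> w v \<notin> nonneg_span D}"
  have "finite ?bad"
    by (rule finite_rays_made_negative[OF D w]) (use b reduced in auto)
  then have "finite (b -` ?bad)" using b(1) by (rule finite_vimageI)
  then obtain N where N: "\<And>n. n \<in> b -` ?bad \<Longrightarrow> n < N"
    using finite_nat_set_iff_bounded by auto
  have "w (b (n + N)) \<in> nonneg_span D" for n
    using N[of "n + N"] b(3)[of "n + N"] by auto
  moreover have "(\<lambda>n. l (w (b (n + N)))) \<longlonglongrightarrow> l (w x)" if "linear l" for l :: "'v \<Rightarrow> real"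
  proof -
    have "linear (\<lambda>v. l (w v))" using linear_compose[OF linear_W[OF w] that] by (simp add: o_def)
    from LIMSEQ_ignore_initial_segment[OF lim[OF this], of N] show ?thesis .
  qed
  ultimately show ?thesis
    by (rule nonneg_span_closed[OF base_fin[OF D] base_ind[OF D]])
qed

text \<open>Coefficients at level \<open>f = 1\<close> subconverge, and \<open>f x = 1\<close> keeps
  the limit from vanishing. The previous lemma is applied to \<open>b n\<close> with
  \<open>D\<close> and to \<open>- b n\<close> with \<open>E\<close>. The coefficients are exported
  because the reflections in \<open>b n\<close> are later evaluated at \<open>x\<close> by comparing
  \<open>C n\<close> with \<open>c\<close>.\<close>

lemma limit_of_negative_rays:
  assumes D: "root_base D" and E: "root_base E"
    and f: "linear f" "\<And>x. x \<in> D \<Longrightarrow> 0 < f x"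
    and inf: "infinite (neg_rays f D E id)"
  obtains b C c x where "\<And>n. b n \<in> neg_rays f D E id"
    "\<And>n. b n = (\<Sum>\<alpha>\<in>D. C n \<alpha> *\<^sub>R \<alpha>)" "x = (\<Sum>\<alpha>\<in>D. c \<alpha> *\<^sub>R \<alpha>)"
    "\<And>\<alpha>. \<alpha> \<in> D \<Longrightarrow> (\<lambda>n. C n \<alpha>) \<longlonglongrightarrow> c \<alpha>" "f x = 1"
    "\<And>w. w \<in> W \<Longrightarrow> w x \<in> nonneg_span D" "\<And>w. w \<in> W \<Longrightarrow> - w x \<in> nonneg_span E"
proof -
  obtain b0 :: "nat \<Rightarrow> 'v" where b0: "inj b0" "range b0 \<subseteq> neg_rays f D E id"
    using infinite_countable_subset[OF inf] by blast
  have b0_in: "b0 n \<in> neg_rays f D E id" for n using b0(2) by blast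
  have b0D: "b0 n \<in> nonneg_span D" "f (b0 n) \<le> 1" for n using b0_in[of n] by (auto simp: neg_rays_def)
  obtain r C c where r: "strict_mono (r :: nat \<Rightarrow> nat)" "\<And>x. x \<in> D \<Longrightarrow> 0 \<le> c x"
    "\<And>n. b0 (r n) = (\<Sum>x\<in>D. C n x *\<^sub>R x)" "\<And>x. x \<in> D \<Longrightarrow> (\<lambda>n. C n x) \<longlonglongrightarrow> c x"
    by (rule nonneg_span_compact[of D f b0 1, OF base_fin[OF D] f b0D]) (assumption, blast)
  define b where "b n = b0 (r n)" for n
  define x where "x = (\<Sum>\<alpha>\<in>D. c \<alpha> *\<^sub>R \<alpha>)"
  have b: "b n \<in> neg_rays f D E id" for n using b0_in by (simp add: b_def)
  have bC: "b n = (\<Sum>\<alpha>\<in>D. C n \<alpha> *\<^sub>R \<alpha>)" for n by (simp add: b_def r(3))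
  have lim: "(\<lambda>n. l (b n)) \<longlonglongrightarrow> l x" if "linear l" for l :: "'v \<Rightarrow> real"
    unfolding bC x_def by (rule tendsto_functional_sum[OF that r(4)])
  have fb: "f (b n) = 1" for n using b by (simp add: neg_rays_def)
  have inj: "inj b" unfolding b_def
    by (rule injI) (metis injD[OF b0(1)] strict_mono_eq[OF r(1)])
  have red: "k = 1" if "k *\<^sub>R b n = b m" for k n m
    using arg_cong[OF that, of f] by (simp add: linear_scale[OF f(1)] fb)
  have red': "k = 1" if "k *\<^sub>R - b n = - b m" for k n m using red[of k n m] that by simp
  show thesis
  proof (rule that[OF b bC x_def r(4)])
    have "(\<lambda>n. f (b n)) \<longlonglongrightarrow> f x" by (rule lim[OF f(1)])
    then show "f x = 1" by (simp add: fb LIMSEQ_const_iff)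
    fix w assume w: "w \<in> W"
    show "w x \<in> nonneg_span D"
      by (rule limit_of_rays_invariant[OF D w inj _ _ red lim]) (use b in \<open>auto simp: neg_rays_def\<close>)
    have "w (- x) \<in> nonneg_span E"
    proof (rule limit_of_rays_invariant[OF E w, of "\<lambda>n. - b n"])
      show "inj (\<lambda>n. - b n)" using inj by (simp add: inj_def)
      show "- b n \<in> rays" for n
      proof -
        obtain k where "k > 0" "k *\<^sub>R b n \<in> R" using b[of n] by (auto simp: neg_rays_def rays_def)
        then have "k *\<^sub>R - b n \<in> R" using uminus_R(1)[of "k *\<^sub>R b n"] by simp
        then show ?thesis using \<open>k > 0\<close> unfolding rays_def by blast
      qed
      show "- b n \<in> nonneg_span E" for n using b[of n] by (simp add: neg_rays_def)
      show "k = 1" if "k *\<^sub>R - b n = - b m" for k n m by (rule red'[OF that])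
      show "(\<lambda>n. l (- b n)) \<longlonglongrightarrow> l (- x)" if "linear l" for l :: "'v \<Rightarrow> real"
        using tendsto_minus[OF lim[OF that]] by (simp add: linear_neg[OF that])
    qed
    then show "- w x \<in> nonneg_span E" by (simp add: linear_neg[OF linear_W[OF w]])
  qed
qed

text \<open>If \<open>b\<^sub>n \<rightarrow> x\<close> are rays whose signs for \<open>D\<close> and \<open>E\<close> differ, then the reflections in \<open>b\<^sub>n\<close> cannot
  move a point of the orbit of \<open>y\<close> far in the direction of \<open>x\<close> or of \<open>-x\<close> without leaving one of the
  two cones. Hence the coroots of the \<open>b\<^sub>n\<close> are bounded on the span of the orbit; if this span were
  everything, the limiting reflection would send \<open>x\<close> to \<open>-x\<close>.\<close>

lemma orbit_in_both_cones_fixed: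
  assumes D: "root_base D" and E: "root_base E" and conn: "connected_base D"
    and f: "linear f" "\<And>x. x \<in> D \<Longrightarrow> 0 < f x"
    and inf: "infinite (neg_rays f D E id)"
    and y: "\<And>w. w \<in> W \<Longrightarrow> w y \<in> nonneg_span D" "\<And>w. w \<in> W \<Longrightarrow> w y \<in> nonneg_span E"
    and \<alpha>: "\<alpha> \<in> D"
  shows "cr \<alpha> y = 0"
proof (rule ccontr)
  assume ne: "cr \<alpha> y \<noteq> 0"
  obtain b C c x where b: "\<And>n. b n \<in> neg_rays f D E id"
    and bC: "\<And>n. b n = (\<Sum>\<alpha>\<in>D. C n \<alpha> *\<^sub>R \<alpha>)" and xc: "x = (\<Sum>\<alpha>\<in>D. c \<alpha> *\<^sub>R \<alpha>)"
    and C: "\<And>\<alpha>. \<alpha> \<in> D \<Longrightarrow> (\<lambda>n. C n \<alpha>) \<longlonglongrightarrow> c \<alpha>" and fx: "f x = 1"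
    and xD: "\<And>w. w \<in> W \<Longrightarrow> w x \<in> nonneg_span D" and xE: "\<And>w. w \<in> W \<Longrightarrow> - w x \<in> nonneg_span E"
    by (rule limit_of_negative_rays[OF D E f inf]) (assumption, blast)
  obtain g :: "'v \<Rightarrow> real" where g: "linear g" "\<And>x. x \<in> E \<Longrightarrow> 0 < g x"
    by (rule positive_functional[OF base_fin[OF E] base_ind[OF E]]) blast
  have fb: "f (b n) = 1" for n using b by (simp add: neg_rays_def)
  have "\<forall>n. \<exists>k. k > 0 \<and> k *\<^sub>R b n \<in> R" using b by (auto simp: neg_rays_def rays_def)
  then obtain k where k: "\<And>n. k n > 0" "\<And>n. k n *\<^sub>R b n \<in> R" by metis
  \<comment> \<open>Passing from the root \<open>k n *\<^sub>R b n\<close> to \<open>b n\<close>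
    rescales the coroot inversely; \<open>\<phi> n\<close> is the functional with
    \<open>s n v = v - \<phi> n v *\<^sub>R b n\<close>.\<close>
  define \<phi> where "\<phi> n v = k n * cr (k n *\<^sub>R b n) v" for n v
  define s where "s n = rf (k n *\<^sub>R b n)" for n
  have s_W: "s n \<in> W" for n unfolding s_def by (rule rf_W[OF k(2)])
  have s: "s n v = v - \<phi> n v *\<^sub>R b n" for n v by (simp add: s_def rf_def \<phi>_def mult.commute)
  have \<phi>_lin: "linear (\<phi> n)" for n
    using linear_compose_scale_right[OF cr_linear[OF k(2)[of n]], of "k n"] by (simp add: \<phi>_def[abs_def])
  have \<phi>_b: "\<phi> n (b n) = 2" for n
    using cr_self[OF k(2)[of n]] linear_scale[OF cr_linear[OF k(2)[of n]], of "k n" "b n"]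
    by (simp add: \<phi>_def)
  define \<delta> where "\<delta> = g (- x)"
  have "- x \<in> nonneg_span E" using xE[OF id_W] by simp
  moreover have "- x \<noteq> 0" using fx linear_0[OF f(1)] by auto
  ultimately have \<delta>: "\<delta> > 0" unfolding \<delta>_def by (intro functional_pos[OF base_fin[OF E] g])
  have "(\<lambda>n. g (b n)) \<longlonglongrightarrow> g x" unfolding bC xc by (rule tendsto_functional_sum[OF g(1) C])
  then have "(\<lambda>n. g (- b n)) \<longlonglongrightarrow> \<delta>"
    unfolding \<delta>_def linear_neg[OF g(1)] by (rule tendsto_minus)
  \<comment> \<open>That \<open>g (- b n)\<close> stays away from zero yields the lower bound on
    \<open>\<phi> n\<close> below, just as \<open>f (b n) = 1\<close> yields the upper one.\<close>
  then have ev: "\<forall>\<^sub>F n in sequentially. \<delta> / 2 < g (- b n)"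
    by (rule order_tendstoD) (use \<delta> in simp)
  have orbit: "Bseq (\<lambda>n. \<phi> n (w y))" if w: "w \<in> W" for w
  proof (rule BfunI[of _ "f (w y) + 2 * g (w y) / \<delta>"], use ev in eventually_elim)
    case (elim n)
    have "(s n \<circ> w) y \<in> nonneg_span D" "(s n \<circ> w) y \<in> nonneg_span E"
      using y comp_W[OF s_W w] by blast+
    then have sD: "0 \<le> f (s n (w y))" and sE: "0 \<le> g (s n (w y))"
      using functional_nonneg[OF base_fin[OF D] f] functional_nonneg[OF base_fin[OF E] g] by auto
    have gy: "0 \<le> g (w y)" by (rule functional_nonneg[OF base_fin[OF E] g y(2)[OF w]])
    have fy: "0 \<le> f (w y)" by (rule functional_nonneg[OF base_fin[OF D] f y(1)[OF w]])
    have up: "\<phi> n (w y) \<le> f (w y)"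
      using sD by (simp add: s linear_diff[OF f(1)] linear_scale[OF f(1)] fb)
    have down: "0 \<le> g (w y) + \<phi> n (w y) * g (- b n)"
      using sE by (simp add: s linear_diff[OF g(1)] linear_scale[OF g(1)] linear_neg[OF g(1)])
    have "- (2 * g (w y) / \<delta>) \<le> \<phi> n (w y)"
    proof (cases "\<phi> n (w y) \<ge> 0")
      case True
      moreover have "0 \<le> 2 * g (w y) / \<delta>" using gy \<delta> by simp
      ultimately show ?thesis by linarith
    next
      case False
      then have "\<phi> n (w y) * g (- b n) \<le> \<phi> n (w y) * (\<delta> / 2)"
        using elim by (intro mult_left_mono_neg) auto
      then have "- \<phi> n (w y) * \<delta> \<le> 2 * g (w y)" using down by simp
      then have "- \<phi> n (w y) \<le> 2 * g (w y) / \<delta>" using \<delta> by (simp add: pos_le_divide_eq)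
      then show ?thesis by simp
    qed
    moreover have "0 \<le> 2 * g (w y) / \<delta>" using gy \<delta> by simp
    ultimately show ?case using up fy by (simp add: abs_le_iff)
  qed
  \<comment> \<open>The vectors on which the \<open>\<phi> n\<close> stay bounded form a subspace.
    It contains the orbit of \<open>y\<close>, hence also the invariant span \<open>M\<close> of
    that orbit.\<close>
  define L where "L = {v. Bseq (\<lambda>n. \<phi> n v)}"
  have sub: "subspace L"
  proof (rule subspaceI)
    show "0 \<in> L" by (simp add: L_def linear_0[OF \<phi>_lin])
    show "v + v' \<in> L" if vL: "v \<in> L" "v' \<in> L" for v v'
    proof -
      obtain K where K: "\<And>n. norm (\<phi> n v) \<le> K" using vL by (auto simp: L_def Bseq_def)
      obtain K' where K': "\<And>n. norm (\<phi> n v') \<le> K'" using vL by (auto simp: L_def Bseq_def)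
      have "norm (\<phi> n (v + v')) \<le> K + K'" for n
        using norm_triangle_mono[OF K K'] by (simp add: linear_add[OF \<phi>_lin])
      then show ?thesis unfolding L_def by (intro CollectI BseqI')
    qed
    show "t *\<^sub>R v \<in> L" if "v \<in> L" for t v
      using that Bseq_mult[of "\<lambda>_. t" "\<lambda>n. \<phi> n v"] by (simp add: L_def linear_scale[OF \<phi>_lin])
  qed
  define M where "M = span ((\<lambda>w. w y) ` W)"
  have "M \<subseteq> L" unfolding M_def by (rule span_minimal[OF _ sub]) (use orbit in \<open>auto simp: L_def\<close>)
  have subM: "subspace M" by (simp add: M_def)
  have M_W: "w v \<in> M" if "w \<in> W" "v \<in> M" for w v
  proof -
    have "w ` (\<lambda>w. w y) ` W \<subseteq> (\<lambda>w. w y) ` W"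
    proof clarify
      fix u assume "u \<in> W"
      then have "w \<circ> u \<in> W" using comp_W that(1) by blast
      then show "w (u y) \<in> (\<lambda>w. w y) ` W" by (intro image_eqI[of _ _ "w \<circ> u"]) auto
    qed
    then have "span (w ` (\<lambda>w. w y) ` W) \<subseteq> M" unfolding M_def by (rule span_mono)
    then show ?thesis
      using that(2) linear_span_image[OF linear_W[OF that(1)], of "(\<lambda>w. w y) ` W"] by (auto simp: M_def)
  qed
  \<comment> \<open>The difference \<open>v - rf \<beta> v\<close> lies in \<open>M\<close> and is a
    nonzero multiple of \<open>\<beta>\<close>. Starting from \<open>y\<close>, membership in
    \<open>M\<close> thus reaches \<open>\<alpha>\<close> and spreads along the Coxeter
    graph.\<close>
  have step: "\<beta> \<in> M" if "\<beta> \<in> D" "v \<in> M" "cr \<beta> v \<noteq> 0" for \<beta> v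
  proof -
    have "v - rf \<beta> v \<in> M" using M_W[OF base_rf_W[OF D]] that subspace_diff[OF subM] by blast
    then have "cr \<beta> v *\<^sub>R \<beta> \<in> M" by (simp add: rf_def)
    from subspace_scale[OF subM this, of "inverse (cr \<beta> v)"] show ?thesis using that(3) by simp
  qed
  have "y \<in> M" using span_base[OF imageI[OF id_W, of "\<lambda>w. w y"]] by (simp add: M_def)
  then have "\<alpha> \<in> D \<inter> M" using step \<alpha> ne by blast
  then have "D \<inter> M = D"
    using step by (intro conn[unfolded connected_base_def, rule_format]) auto
  then have DL: "D \<subseteq> L" using \<open>M \<subseteq> L\<close> by blast
  have null: "(\<lambda>n. (C n \<beta> - c \<beta>) * \<phi> n \<beta>) \<longlonglongrightarrow> 0" if \<beta>: "\<beta> \<in> D" for \<beta>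
  proof -
    obtain K where K: "\<And>n. norm (\<phi> n \<beta>) \<le> K" using \<beta> DL by (auto simp: L_def Bseq_def)
    have "(\<lambda>n. C n \<beta> - c \<beta>) \<longlonglongrightarrow> 0" using C[OF \<beta>] by (simp add: LIM_zero)
    then show ?thesis
      by (rule tendsto_0_le[of _ _ _ K]) (use K in \<open>simp add: abs_mult mult_left_mono\<close>)
  qed
  \<comment> \<open>\<open>\<phi> n\<close> is 2 at \<open>b n\<close>, and \<open>x\<close> differs
    from \<open>b n\<close> by vanishing coefficients on simple roots, where \<open>\<phi> n\<close>
    is bounded; so \<open>\<phi> n x\<close> tends to 2.\<close>
  have \<phi>x: "\<phi> n x = 2 - (\<Sum>\<beta>\<in>D. (C n \<beta> - c \<beta>) * \<phi> n \<beta>)" for n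
  proof -
    have "\<phi> n (b n) = (\<Sum>\<beta>\<in>D. C n \<beta> * \<phi> n \<beta>)"
      by (subst bC) (simp add: linear_sum[OF \<phi>_lin] linear_scale[OF \<phi>_lin])
    moreover have "\<phi> n x = (\<Sum>\<beta>\<in>D. c \<beta> * \<phi> n \<beta>)"
      by (simp add: xc linear_sum[OF \<phi>_lin] linear_scale[OF \<phi>_lin])
    ultimately show ?thesis by (simp add: \<phi>_b left_diff_distrib sum_subtractf)
  qed
  have "(\<lambda>n. \<phi> n x) \<longlonglongrightarrow> 2 - (\<Sum>\<beta>\<in>D. 0)"
    unfolding \<phi>x by (intro tendsto_diff tendsto_const tendsto_sum null)
  \<comment> \<open>The point \<open>s n x\<close> is still in the cone of \<open>D\<close>, and
    \<open>f\<close> takes the value \<open>1 - \<phi> n x\<close> there.\<close>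
  moreover have "\<phi> n x \<le> 1" for n
  proof -
    have "0 \<le> f (s n x)" by (rule functional_nonneg[OF base_fin[OF D] f xD[OF s_W]])
    then show ?thesis by (simp add: s linear_diff[OF f(1)] linear_scale[OF f(1)] fb fx)
  qed
  ultimately have "2 - (\<Sum>\<beta>\<in>D. 0) \<le> (1::real)" by (intro LIMSEQ_le_const2) auto
  then show False by simp
qed

section \<open>Uniqueness of fixed vectors in the cone\<close>

text \<open>If \<open>c \<alpha> = 0\<close>, pairing with the coroot of \<open>\<alpha>\<close>
  gives a vanishing sum of nonpositive terms. Each term is zero, so the zero set of \<open>c\<close>
  passes to neighbours and, by connectedness, fills \<open>D\<close>.\<close>

lemma fixed_full_support:
  assumes D: "root_base D" and conn: "connected_base D"
    and c: "\<And>\<beta>. \<beta> \<in> D \<Longrightarrow> 0 \<le> c \<beta>"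
    and null: "\<And>\<alpha>. \<alpha> \<in> D \<Longrightarrow> cr \<alpha> (\<Sum>\<beta>\<in>D. c \<beta> *\<^sub>R \<beta>) = 0"
    and \<alpha>: "\<alpha> \<in> D" "c \<alpha> = 0" and \<beta>: "\<beta> \<in> D"
  shows "c \<beta> = 0"
proof -
  let ?A = "{\<beta> \<in> D. c \<beta> = 0}"
  have "\<beta> \<in> ?A" if \<alpha>: "\<alpha> \<in> ?A" and \<beta>: "\<beta> \<in> D" "\<alpha> \<noteq> \<beta>" "cr \<beta> \<alpha> \<noteq> 0" for \<alpha> \<beta>
  proof -
    have aD: "\<alpha> \<in> D" using \<alpha> by blast
    have "(\<Sum>\<gamma>\<in>D. - (c \<gamma> * cr \<alpha> \<gamma>)) = 0"
      using null[OF aD] base_R[OF D aD] by (simp add: linear_sum linear_scale cr_linear sum_negf)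
    moreover have "0 \<le> - (c \<gamma> * cr \<alpha> \<gamma>)" if "\<gamma> \<in> D" for \<gamma>
      using base_le[OF D that aD] c[OF that] \<alpha> by (cases "\<gamma> = \<alpha>") (auto simp: mult_nonneg_nonpos)
    ultimately have "- (c \<beta> * cr \<alpha> \<beta>) = 0"
      using sum_nonneg_eq_0_iff[OF base_fin[OF D], of "\<lambda>\<gamma>. - (c \<gamma> * cr \<alpha> \<gamma>)"] \<beta>(1) by blast
    \<comment> \<open>Adjacency is about \<open>cr \<beta> \<alpha>\<close>, the vanishing sum about
      the transposed entry; the two vanish together.\<close>
    moreover have "cr \<alpha> \<beta> \<noteq> 0" using base_sym[OF D \<beta>(1) aD] \<beta> by blast
    ultimately show ?thesis using \<beta>(1) by simp
  qed
  moreover have "?A \<noteq> {}" using \<alpha> by blast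
  ultimately have "?A = D" by (intro conn[unfolded connected_base_def, rule_format]) auto
  then show ?thesis using \<beta> by blast
qed

text \<open>Subtract from \<open>y\<close> the largest multiple of \<open>x\<close> that keeps the
  coefficients nonnegative. One coefficient becomes zero, hence all do, because the difference is
  again fixed.\<close>

lemma fixed_proportional:
  assumes D: "root_base D" and conn: "connected_base D"
    and x: "x \<in> nonneg_span D" "x \<noteq> 0" "\<And>\<alpha>. \<alpha> \<in> D \<Longrightarrow> cr \<alpha> x = 0"
    and y: "y \<in> nonneg_span D" "\<And>\<alpha>. \<alpha> \<in> D \<Longrightarrow> cr \<alpha> y = 0"
  obtains t where "t \<ge> 0" "y = t *\<^sub>R x"
proof -
  obtain c where c: "\<And>x. x \<in> D \<Longrightarrow> 0 \<le> c x" "x = (\<Sum>x\<in>D. c x *\<^sub>R x)"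
    using nonneg_spanE[OF base_fin[OF D] x(1)] by blast
  obtain d where d: "\<And>x. x \<in> D \<Longrightarrow> 0 \<le> d x" "y = (\<Sum>x\<in>D. d x *\<^sub>R x)"
    using nonneg_spanE[OF base_fin[OF D] y(1)] by blast
  have cpos: "0 < c \<alpha>" if \<alpha>: "\<alpha> \<in> D" for \<alpha>
  proof (rule ccontr)
    assume "\<not> 0 < c \<alpha>"
    then have "c \<alpha> = 0" using c(1)[OF \<alpha>] by simp
    have "c \<beta> = 0" if "\<beta> \<in> D" for \<beta>
      by (rule fixed_full_support[of D c \<alpha> \<beta>, OF D conn c(1) _ \<alpha> \<open>c \<alpha> = 0\<close> that]) (use x(3) c(2) in auto)
    then show False using x(2) c(2) by simp
  qed
  have "D \<noteq> {}" using x(2) c(2) by auto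
  define t where "t = Min ((\<lambda>\<alpha>. d \<alpha> / c \<alpha>) ` D)"
  have "t \<in> (\<lambda>\<alpha>. d \<alpha> / c \<alpha>) ` D"
    unfolding t_def using \<open>D \<noteq> {}\<close> base_fin[OF D] by (intro Min_in) auto
  then obtain \<alpha> where \<alpha>: "\<alpha> \<in> D" "t = d \<alpha> / c \<alpha>" by blast
  have le: "t \<le> d \<beta> / c \<beta>" if "\<beta> \<in> D" for \<beta>
    unfolding t_def using that base_fin[OF D] by (intro Min_le) auto
  have eq: "(\<Sum>\<beta>\<in>D. (d \<beta> - t * c \<beta>) *\<^sub>R \<beta>) = y - t *\<^sub>R x"
    unfolding c(2) d(2) by (simp add: scaleR_diff_left sum_subtractf scaleR_sum_right)
  have "d \<beta> - t * c \<beta> = 0" if "\<beta> \<in> D" for \<beta>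
  proof (rule fixed_full_support[OF D conn _ _ \<alpha>(1) _ that])
    show "0 \<le> d \<beta> - t * c \<beta>" if "\<beta> \<in> D" for \<beta>
      using le[OF that] cpos[OF that] by (simp add: pos_le_divide_eq)
    show "cr \<alpha>' (\<Sum>\<beta>\<in>D. (d \<beta> - t * c \<beta>) *\<^sub>R \<beta>) = 0" if "\<alpha>' \<in> D" for \<alpha>'
      unfolding eq using x(3)[OF that] y(2)[OF that] base_R[OF D that]
      by (simp add: linear_diff linear_scale cr_linear)
    show "d \<alpha> - t * c \<alpha> = 0" using \<alpha> cpos[OF \<alpha>(1)] by simp
  qed
  then have "y = t *\<^sub>R x" using eq by simp
  moreover have "t \<ge> 0" using \<alpha> d(1) c(1) by simp
  ultimately show thesis by (rule that[rotated])
qed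

lemma finite_neg_rays_cases:
  assumes D: "root_base D" and E: "root_base E" and conn: "connected_base D"
    and f: "linear f" "\<And>x. x \<in> D \<Longrightarrow> 0 < f x"
  shows "finite (neg_rays f D E id) \<or> finite (neg_rays f D (uminus ` E) id)"
proof (rule ccontr)
  assume "\<not> ?thesis"
  then have inf: "infinite (neg_rays f D E id)" "infinite (neg_rays f D (uminus ` E) id)" by auto
  have E': "root_base (uminus ` E)" by (rule root_base_uminus[OF E])
  have flip: "v \<in> nonneg_span (uminus ` E) \<longleftrightarrow> - v \<in> nonneg_span E" for v
    by (rule nonneg_span_uminus[OF base_fin[OF E]])
  obtain x where x: "f x = 1" "\<And>w. w \<in> W \<Longrightarrow> w x \<in> nonneg_span D" "\<And>w. w \<in> W \<Longrightarrow> - w x \<in> nonneg_span E"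
    by (rule limit_of_negative_rays[OF D E f inf(1)]) (assumption, blast)
  obtain y where y: "f y = 1" "\<And>w. w \<in> W \<Longrightarrow> w y \<in> nonneg_span D"
    "\<And>w. w \<in> W \<Longrightarrow> - w y \<in> nonneg_span (uminus ` E)"
    by (rule limit_of_negative_rays[OF D E' f inf(2)]) (assumption, blast)
  have yE: "w y \<in> nonneg_span E" if "w \<in> W" for w using y(3)[OF that] by (simp add: flip)
  have xE: "w x \<in> nonneg_span (uminus ` E)" if "w \<in> W" for w using x(3)[OF that] by (simp add: flip)
  \<comment> \<open>The rays approaching \<open>x\<close> make \<open>y\<close> fixed. Those
    approaching \<open>y\<close>, with the negative of \<open>E\<close> in place of
    \<open>E\<close>, make \<open>x\<close> fixed.\<close>
  have fy: "cr \<alpha> y = 0" if "\<alpha> \<in> D" for \<alpha>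
    by (rule orbit_in_both_cones_fixed[OF D E conn f inf(1) y(2) yE that])
  have fx: "cr \<alpha> x = 0" if "\<alpha> \<in> D" for \<alpha>
    by (rule orbit_in_both_cones_fixed[OF D E' conn f inf(2) x(2) xE that])
  have "x \<noteq> 0" "y \<noteq> 0" using x(1) y(1) linear_0[OF f(1)] by auto
  have xD: "x \<in> nonneg_span D" and yD: "y \<in> nonneg_span D" using x(2)[OF id_W] y(2)[OF id_W] by auto
  obtain t where t: "t \<ge> 0" "y = t *\<^sub>R x"
    by (rule fixed_proportional[OF D conn xD \<open>x \<noteq> 0\<close> fx yD fy])
  have "t *\<^sub>R - x \<in> nonneg_span E"
    using x(3)[OF id_W] t(1) by (intro nonneg_span_scale base_fin[OF E]) auto
  then have "- y \<in> nonneg_span E" using t(2) by simp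
  moreover have "y \<in> nonneg_span E" using yE[OF id_W] by simp
  ultimately show False using base_pointed[OF E] \<open>y \<noteq> 0\<close> by blast
qed

section \<open>Descent by simple reflections, and matching of the bases\<close>

text \<open>If \<open>w \<alpha>\<close> is negative for a simple root \<open>\<alpha>\<close>, pass
  to \<open>w \<circ> rf \<alpha>\<close>: reflecting and rescaling injects the new set of rays into
  the old one without the ray of \<open>\<alpha>\<close>, so the count drops.\<close>

lemma exists_positive_translate:
  assumes D: "root_base D" and E: "root_base E"
    and f: "linear f" "\<And>x. x \<in> D \<Longrightarrow> 0 < f x"
    and "w \<in> W" "finite (neg_rays f D E w)"
  shows "\<exists>u\<in>W. \<forall>\<alpha>\<in>D. u \<alpha> \<in> nonneg_span E"
  using assms(5,6)
proof (induction "card (neg_rays f D E w)" arbitrary: w rule: less_induct)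
  case less
  show ?case
  proof (cases "\<forall>\<alpha>\<in>D. w \<alpha> \<in> nonneg_span E")
    case True
    then show ?thesis using less.prems by blast
  next
    case False
    then obtain \<alpha> where \<alpha>: "\<alpha> \<in> D" "w \<alpha> \<notin> nonneg_span E" by blast
    have \<alpha>R: "\<alpha> \<in> R" by (rule base_R[OF D \<alpha>(1)])
    have lin_w: "linear w" by (rule linear_W[OF less.prems(1)])
    have lin_s: "linear (rf \<alpha>)" by (rule linear_W[OF rf_W[OF \<alpha>R]])
    have neg: "- w \<alpha> \<in> nonneg_span E" using base_pm[OF E W_R[OF less.prems(1) \<alpha>R]] \<alpha>(2) by blast
    define w' where "w' = w \<circ> rf \<alpha>"
    have w'W: "w' \<in> W" unfolding w'_def by (rule comp_W[OF less.prems(1) rf_W[OF \<alpha>R]])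
    \<comment> \<open>\<open>F\<close> reflects and returns to level \<open>f = 1\<close>;
      \<open>a\<close> is the point of the ray of \<open>\<alpha>\<close> at that level.\<close>
    define F where "F b = inverse (f (rf \<alpha> b)) *\<^sub>R rf \<alpha> b" for b
    define a where "a = inverse (f \<alpha>) *\<^sub>R \<alpha>"
    have f\<alpha>: "f \<alpha> > 0" by (rule f(2)[OF \<alpha>(1)])
    \<comment> \<open>\<open>w'\<close> sends \<open>\<alpha>\<close> to
      \<open>- w \<alpha>\<close>, which is positive for \<open>E\<close>, so the new set contains
      no multiple of \<open>\<alpha>\<close>. Hence \<open>rf \<alpha>\<close> keeps its rays
      positive for \<open>D\<close>, and the division in \<open>F\<close> is legitimate.\<close>
    have main: "b \<noteq> t *\<^sub>R \<alpha> \<and> rf \<alpha> b \<in> nonneg_span D \<and> 0 < f (rf \<alpha> b)"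
      if b: "b \<in> neg_rays f D E w'" for b t
    proof -
      have b': "b \<in> rays" "b \<in> nonneg_span D" "f b = 1" "- w (rf \<alpha> b) \<in> nonneg_span E"
        using b by (auto simp: neg_rays_def w'_def)
      have no: "b \<noteq> t *\<^sub>R \<alpha>" for t
      proof
        assume eq: "b = t *\<^sub>R \<alpha>"
        then have "t * f \<alpha> = 1" using b'(3) by (simp add: linear_scale[OF f(1)])
        then have "t > 0" using f\<alpha> by (metis zero_less_mult_pos2 zero_less_one)
        have "- w (rf \<alpha> b) = t *\<^sub>R w \<alpha>"
          by (simp add: eq linear_scale[OF lin_s] linear_scale[OF lin_w] rf_self[OF \<alpha>R] linear_neg[OF lin_w])
        then show False using b'(4) \<alpha>(2) nonneg_span_scale_iff[OF base_fin[OF E] \<open>t > 0\<close>] by simp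
      qed
      have "rf \<alpha> b \<in> nonneg_span D"
      proof (rule ccontr)
        assume "rf \<alpha> b \<notin> nonneg_span D"
        then obtain t where "b = t *\<^sub>R \<alpha>"
          by (rule simple_reflection_permutes_rays[OF D \<alpha>(1) b'(1,2)])
        then show False using no by blast
      qed
      moreover have "rf \<alpha> b \<noteq> 0" using zero_notin_rays[OF W_rays[OF rf_W[OF \<alpha>R] b'(1)]] .
      ultimately show ?thesis using no functional_pos[OF base_fin[OF D] f, of "rf \<alpha> b"] by blast
    qed
    have inj: "inj_on F (neg_rays f D E w')"
    proof (rule inj_onI)
      fix b1 b2 assume b: "b1 \<in> neg_rays f D E w'" "b2 \<in> neg_rays f D E w'" and eq: "F b1 = F b2"
      define k where "k = f (rf \<alpha> b1) * inverse (f (rf \<alpha> b2))"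
      have "rf \<alpha> b1 = f (rf \<alpha> b1) *\<^sub>R F b1" using main[OF b(1), of 0] by (simp add: F_def)
      also have "\<dots> = k *\<^sub>R rf \<alpha> b2" by (simp add: eq) (simp add: F_def k_def)
      finally have "rf \<alpha> b1 = rf \<alpha> (k *\<^sub>R b2)" by (simp add: linear_scale[OF lin_s])
      then have *: "b1 = k *\<^sub>R b2" by (rule W_inj[OF rf_W[OF \<alpha>R]])
      then have "k = 1" using b arg_cong[OF *, of f] by (simp add: neg_rays_def linear_scale[OF f(1)])
      then show "b1 = b2" using * by simp
    qed
    have image: "F ` neg_rays f D E w' \<subseteq> neg_rays f D E w - {a}"
    proof (rule image_subsetI)
      fix b assume b: "b \<in> neg_rays f D E w'"
      have b': "b \<in> rays" "b \<in> nonneg_span D" "f b = 1" "- w (rf \<alpha> b) \<in> nonneg_span E"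
        using b by (auto simp: neg_rays_def w'_def)
      have pos: "0 < inverse (f (rf \<alpha> b))" and sD: "rf \<alpha> b \<in> nonneg_span D" using main[OF b] by auto
      have "F b \<in> rays" unfolding F_def by (rule scale_rays[OF W_rays[OF rf_W[OF \<alpha>R] b'(1)] pos])
      moreover have "F b \<in> nonneg_span D"
        unfolding F_def using nonneg_span_scale[OF base_fin[OF D] sD] pos by simp
      moreover have "f (F b) = 1" using pos by (simp add: F_def linear_scale[OF f(1)])
      moreover have "- w (F b) \<in> nonneg_span E"
        using nonneg_span_scale[OF base_fin[OF E] b'(4), of "inverse (f (rf \<alpha> b))"] pos
        by (simp add: F_def linear_scale[OF lin_w])
      \<comment> \<open>Otherwise \<open>rf \<alpha> b\<close>, and with it \<open>b\<close>, would
        be a multiple of \<open>\<alpha>\<close>, which \<open>main\<close> excludes.\<close>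
      moreover have "F b \<noteq> a"
      proof
        assume "F b = a"
        then have "f (rf \<alpha> b) *\<^sub>R F b = (f (rf \<alpha> b) * inverse (f \<alpha>)) *\<^sub>R \<alpha>" by (simp add: a_def)
        then have "rf \<alpha> b = (f (rf \<alpha> b) * inverse (f \<alpha>)) *\<^sub>R \<alpha>" using pos by (simp add: F_def)
        from arg_cong[OF this, of "rf \<alpha>"]
        have "rf \<alpha> (rf \<alpha> b) = - (f (rf \<alpha> b) * inverse (f \<alpha>)) *\<^sub>R \<alpha>"
          by (simp add: linear_scale[OF lin_s] rf_self[OF \<alpha>R])
        then show False using main[OF b, of "- (f (rf \<alpha> b) * inverse (f \<alpha>))"] rf_rf[OF \<alpha>R] by simp
      qed
      ultimately show "F b \<in> neg_rays f D E w - {a}" by (simp add: neg_rays_def)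
    qed
    have "a \<in> neg_rays f D E w"
    proof -
      have "a \<in> rays" unfolding a_def using f\<alpha> by (intro raysI \<alpha>R) simp
      moreover have "a \<in> nonneg_span D"
        unfolding a_def using f\<alpha> \<alpha> by (intro nonneg_span_scale nonneg_span_base base_fin[OF D]) auto
      moreover have "f a = 1" using f\<alpha> by (simp add: a_def linear_scale[OF f(1)])
      moreover have "- w a \<in> nonneg_span E"
        using nonneg_span_scale[OF base_fin[OF E] neg, of "inverse (f \<alpha>)"] f\<alpha>
        by (simp add: a_def linear_scale[OF lin_w])
      ultimately show ?thesis by (simp add: neg_rays_def)
    qed
    then have lt: "card (neg_rays f D E w - {a}) < card (neg_rays f D E w)"
      by (intro psubset_card_mono less.prems) blast
    have fin: "finite (neg_rays f D E w - {a})" using less.prems by simp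
    have "card (neg_rays f D E w') \<le> card (neg_rays f D E w - {a})"
      by (rule card_inj_on_le[OF inj image fin])
    moreover have "finite (neg_rays f D E w')" by (rule inj_on_finite[OF inj image fin])
    ultimately show ?thesis using less.hyps[of w'] w'W lt by linarith
  qed
qed

text \<open>\<open>u\<close> carries the cone of \<open>D\<close> onto that of \<open>E\<close>: if
  its inverse made some \<open>\<beta>\<close> in \<open>E\<close> negative, applying
  \<open>u\<close> again would contradict that the cone of \<open>E\<close> is pointed. The bases
  then match because their elements represent the extremal rays.\<close>

lemma base_eq_translate:
  assumes D: "root_base D" and E: "root_base E" and u: "u \<in> W"
    and pos: "\<And>\<alpha>. \<alpha> \<in> D \<Longrightarrow> u \<alpha> \<in> nonneg_span E"
  shows "\<exists>c. (\<forall>\<alpha>\<in>D. (0::real) < c \<alpha>) \<and> E = {c \<alpha> *\<^sub>R u \<alpha> | \<alpha>. \<alpha> \<in> D}"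
proof -
  have lin_u: "linear u" by (rule linear_W[OF u])
  obtain v where v: "v \<in> W" "v \<circ> u = id" "u \<circ> v = id" using inv_W[OF u] by blast
  have uv: "u (v x) = x" and vu: "v (u x) = x" for x using v by (metis comp_apply id_apply)+
  have lin_v: "linear v" by (rule linear_W[OF v(1)])
  have transfer: "u x \<in> nonneg_span E" if x: "x \<in> nonneg_span D" for x
  proof -
    obtain c where c: "\<And>x. x \<in> D \<Longrightarrow> 0 \<le> c x" "x = (\<Sum>x\<in>D. c x *\<^sub>R x)"
      using nonneg_spanE[OF base_fin[OF D] x] by blast
    have "u x = (\<Sum>x\<in>D. c x *\<^sub>R u x)" by (simp add: c(2) linear_sum[OF lin_u] linear_scale[OF lin_u])
    then show ?thesis
      using c(1) pos by (auto intro!: nonneg_span_sum nonneg_span_scale base_fin[OF E])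
  qed
  have neg: "v \<beta> \<in> nonneg_span D" if \<beta>: "\<beta> \<in> E" for \<beta>
  proof (rule ccontr)
    assume "v \<beta> \<notin> nonneg_span D"
    then have "- v \<beta> \<in> nonneg_span D" using base_pm[OF D W_R[OF v(1) base_R[OF E \<beta>]]] by blast
    then have "- \<beta> \<in> nonneg_span E" using transfer by (force simp: linear_neg[OF lin_u] uv)
    then have "\<beta> = 0" using base_pointed[OF E nonneg_span_base[OF \<beta>]] by blast
    then show False using base_R[OF E \<beta>] zero_notin_R by blast
  qed
  \<comment> \<open>By extremality, a nonzero term in a decomposition of a simple root lies on its
    ray. This is used for the expansion of \<open>u \<alpha>\<close> over \<open>E\<close> moved
    back by \<open>v\<close>, and for that of \<open>v \<beta>\<close> over \<open>D\<close> moved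
    by \<open>u\<close>.\<close>
  have extr: "\<exists>y\<in>Y. \<exists>k>0. z y = k *\<^sub>R x"
    if X: "root_base X" and Y: "finite Y" and x: "x \<in> X" "x = (\<Sum>y\<in>Y. c y *\<^sub>R z y)"
      and nn: "\<And>y. y \<in> Y \<Longrightarrow> 0 \<le> c y" "\<And>y. y \<in> Y \<Longrightarrow> z y \<in> nonneg_span X" for X Y x c z
  proof -
    have "x \<noteq> 0" using base_R[OF X x(1)] zero_notin_R by blast
    have "\<exists>y\<in>Y. c y *\<^sub>R z y \<noteq> 0"
    proof (rule ccontr)
      assume "\<not> (\<exists>y\<in>Y. c y *\<^sub>R z y \<noteq> 0)"
      then have "(\<Sum>y\<in>Y. c y *\<^sub>R z y) = 0" by (intro sum.neutral) blast
      then show False using x(2) \<open>x \<noteq> 0\<close> by simp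
    qed
    then obtain y where y: "y \<in> Y" "c y *\<^sub>R z y \<noteq> 0" by blast
    have cy: "c y > 0" using nn(1)[OF y(1)] y(2) by (cases "c y = 0") auto
    have "c y *\<^sub>R z y \<in> nonneg_span X"
      using nn y(1) by (intro nonneg_span_scale base_fin[OF X])
    moreover have "(\<Sum>y\<in>Y - {y}. c y *\<^sub>R z y) \<in> nonneg_span X"
      using nn by (intro nonneg_span_sum nonneg_span_scale base_fin[OF X]) auto
    moreover have "c y *\<^sub>R z y + (\<Sum>y\<in>Y - {y}. c y *\<^sub>R z y) = 1 *\<^sub>R x"
      using sum.remove[OF Y y(1), of "\<lambda>y. c y *\<^sub>R z y"] x(2) by simp
    ultimately obtain t where t: "t \<ge> 0" "c y *\<^sub>R z y = t *\<^sub>R x"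
      by (rule base_extremal[OF X x(1)])
    have "t > 0" using t y(2) by (cases "t = 0") auto
    have "z y = inverse (c y) *\<^sub>R (c y *\<^sub>R z y)" using cy by simp
    also have "\<dots> = (inverse (c y) * t) *\<^sub>R x" by (simp add: t(2))
    finally show ?thesis using y(1) cy \<open>t > 0\<close> by (intro bexI[of _ y] exI[of _ "inverse (c y) * t"]) auto
  qed
  have ex1: "\<exists>k>0. k *\<^sub>R u \<alpha> \<in> E" if \<alpha>: "\<alpha> \<in> D" for \<alpha>
  proof -
    obtain e where e: "\<And>x. x \<in> E \<Longrightarrow> 0 \<le> e x" "u \<alpha> = (\<Sum>x\<in>E. e x *\<^sub>R x)"
      using nonneg_spanE[OF base_fin[OF E] pos[OF \<alpha>]] by blast
    have "\<alpha> = (\<Sum>x\<in>E. e x *\<^sub>R v x)"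
      using arg_cong[OF e(2), of v] by (simp add: vu linear_sum[OF lin_v] linear_scale[OF lin_v])
    from extr[OF D base_fin[OF E] \<alpha> this e(1) neg]
    obtain \<beta> k where k: "\<beta> \<in> E" "k > 0" "v \<beta> = k *\<^sub>R \<alpha>" by blast
    then have "k *\<^sub>R u \<alpha> = \<beta>" by (metis uv linear_scale[OF lin_u])
    then show ?thesis using k by blast
  qed
  then obtain c where c: "\<And>\<alpha>. \<alpha> \<in> D \<Longrightarrow> 0 < c \<alpha> \<and> c \<alpha> *\<^sub>R u \<alpha> \<in> E" by metis
  have "\<beta> \<in> {c \<alpha> *\<^sub>R u \<alpha> | \<alpha>. \<alpha> \<in> D}" if \<beta>: "\<beta> \<in> E" for \<beta>
  proof -
    obtain e where e: "\<And>x. x \<in> D \<Longrightarrow> 0 \<le> e x" "v \<beta> = (\<Sum>x\<in>D. e x *\<^sub>R x)"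
      using nonneg_spanE[OF base_fin[OF D] neg[OF \<beta>]] by blast
    have "\<beta> = (\<Sum>x\<in>D. e x *\<^sub>R u x)"
      using arg_cong[OF e(2), of u] by (simp add: uv linear_sum[OF lin_u] linear_scale[OF lin_u])
    from extr[OF E base_fin[OF D] \<beta> this e(1) pos]
    obtain \<alpha> k where k: "\<alpha> \<in> D" "k > 0" "u \<alpha> = k *\<^sub>R \<beta>" by blast
    \<comment> \<open>Both sides lie in \<open>E\<close> and are positively proportional, so
      \<open>base_proportional\<close> fixes the scalar.\<close>
    have "c \<alpha> *\<^sub>R u \<alpha> = \<beta>"
      by (rule base_proportional[OF E \<beta>, of _ "c \<alpha> * k"]) (use c[OF k(1)] k in auto)
    then show ?thesis using k(1) by blast
  qed
  then have "E = {c \<alpha> *\<^sub>R u \<alpha> | \<alpha>. \<alpha> \<in> D}" using c by auto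
  then show ?thesis using c by blast
qed

theorem bases_conjugate:
  assumes D: "root_base D" and E: "root_base E" and conn: "connected_base D"
  shows "\<exists>w\<in>W. \<exists>\<epsilon>\<in>{1, -1 :: real}. \<exists>c. (\<forall>\<alpha>\<in>D. 0 < c \<alpha>) \<and> E = {(\<epsilon> * c \<alpha>) *\<^sub>R w \<alpha> | \<alpha>. \<alpha> \<in> D}"
proof -
  obtain f :: "'v \<Rightarrow> real" where f: "linear f" "\<And>x. x \<in> D \<Longrightarrow> 0 < f x"
    by (rule positive_functional[OF base_fin[OF D] base_ind[OF D]]) blast
  have *: "\<exists>w\<in>W. \<exists>c. (\<forall>\<alpha>\<in>D. 0 < c \<alpha>) \<and> E' = {c \<alpha> *\<^sub>R w \<alpha> | \<alpha>. \<alpha> \<in> D}"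
    if E': "root_base E'" and fin: "finite (neg_rays f D E' id)" for E'
  proof -
    obtain w where w: "w \<in> W" "\<And>\<alpha>. \<alpha> \<in> D \<Longrightarrow> w \<alpha> \<in> nonneg_span E'"
      using exists_positive_translate[OF D E' f id_W fin] by blast
    from base_eq_translate[OF D E' w] show ?thesis using w(1) by blast
  qed
  from finite_neg_rays_cases[OF D E conn f] show ?thesis
  proof
    assume "finite (neg_rays f D E id)"
    from *[OF E this] obtain w c where "w \<in> W" "\<forall>\<alpha>\<in>D. 0 < c \<alpha>" "E = {(1 * c \<alpha>) *\<^sub>R w \<alpha> | \<alpha>. \<alpha> \<in> D}"
      by auto
    then show ?thesis by blast
  next
    assume "finite (neg_rays f D (uminus ` E) id)"
    from *[OF root_base_uminus[OF E] this] obtain w c where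
      w: "w \<in> W" "\<forall>\<alpha>\<in>D. 0 < c \<alpha>" "uminus ` E = {c \<alpha> *\<^sub>R w \<alpha> | \<alpha>. \<alpha> \<in> D}" by blast
    have "E = uminus ` uminus ` E" by (simp add: image_image)
    also have "\<dots> = {(- 1 * c \<alpha>) *\<^sub>R w \<alpha> | \<alpha>. \<alpha> \<in> D}"
      unfolding w(3) by (auto simp: image_iff)
    finally show ?thesis using w(1,2) by blast
  qed
qed

end

section \<open>Based root data\<close>

lemma linear_inv_bij:
  fixes f :: "'a::real_vector \<Rightarrow> 'b::real_vector"
  assumes "linear f" "bij f"
  obtains g where "linear g" "bij g" "g \<circ> f = id"
proof -
  define g where "g = inv_into UNIV f"
  have surj: "f (g x) = x" for x using assms(2) by (simp add: g_def bij_is_surj surj_f_inv_f)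
  have inj: "g (f x) = x" for x using assms(2) by (simp add: g_def bij_is_inj)
  have "linear g"
  proof (rule linearI)
    fix x y c
    have "g (x + y) = g (f (g x + g y))" by (simp add: linear_add[OF assms(1)] surj)
    then show "g (x + y) = g x + g y" by (simp add: inj)
    have "g (c *\<^sub>R x) = g (f (c *\<^sub>R g x))" by (simp add: linear_scale[OF assms(1)] surj)
    then show "g (c *\<^sub>R x) = c *\<^sub>R g x" by (simp add: inj)
  qed
  moreover have "bij g" unfolding g_def by (rule bij_imp_bij_inv[OF assms(2)])
  moreover have "g \<circ> f = id" by (simp add: fun_eq_iff inj)
  ultimately show thesis by (rule that)
qed

lemma carrier_GL: "f \<in> carrier GL \<longleftrightarrow> linear f \<and> bij f"
  and mult_GL: "mult GL = (\<circ>)"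
  and one_GL: "one GL = id"
  by (auto simp: GL_def)

lemma group_GL: "group (GL :: ('a::real_vector \<Rightarrow> 'a) monoid)"
proof (rule groupI)
  fix x y z :: "'a \<Rightarrow> 'a"
  assume "x \<in> carrier GL"
  then have x: "linear x" "bij x" by (auto simp: carrier_GL)
  obtain g where "linear g" "bij g" "g \<circ> x = id" using x by (rule linear_inv_bij)
  then show "\<exists>y\<in>carrier GL. y \<otimes>\<^bsub>GL\<^esub> x = \<one>\<^bsub>GL\<^esub>" by (auto simp: carrier_GL mult_GL one_GL)
qed (auto simp: carrier_GL mult_GL one_GL linear_compose bij_comp linear_id comp_assoc)

lemma reflection_GL:
  assumes "linear (\<lambda>v. p v a')" "p a a' = 2"
  shows "reflection p a a' \<in> carrier GL" "reflection p a a' \<circ> reflection p a a' = id"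
proof -
  have eq: "reflection p a a' (reflection p a a' v) = v" for v
    by (simp add: reflection_def linear_diff[OF assms(1)] linear_scale[OF assms(1)] assms(2))
  then show "reflection p a a' \<circ> reflection p a a' = id" by (simp add: fun_eq_iff)
  have "bij (reflection p a a')" by (rule o_bij[of "reflection p a a'"]) (use eq in auto)
  moreover have "linear (reflection p a a')"
    using assms(1) unfolding reflection_def
    by (intro linearI)
      (simp_all add: linear_add[OF assms(1)] linear_scale[OF assms(1)] scaleR_add_left scaleR_diff_right)
  ultimately show "reflection p a a' \<in> carrier GL" by (simp add: carrier_GL)
qed

section \<open>From a based root datum to a root system\<close>

locale rooted_datum =
  fixes B :: "('v::real_vector, 'w::real_vector) root_basis"
    and p :: "'v \<Rightarrow> 'w \<Rightarrow> real" and \<Phi> :: "'v set" and \<Phi>' :: "'w set" and h :: "'v \<Rightarrow> 'w"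
    and \<rho> :: "('v \<Rightarrow> 'v) \<Rightarrow> 'w \<Rightarrow> 'w"
  assumes datum: "based_root_datum B"
    and underlying: "has_underlying_root_datum B p \<Phi> \<Phi>' h"
    and action: "dual_action B \<rho>"
    and h_equivariant: "w \<in> carrier (weyl_group B) \<Longrightarrow> \<beta> \<in> \<Phi> \<Longrightarrow> h (w \<beta>) = \<rho> w (h \<beta>)"
begin

abbreviation "D \<equiv> simple_roots B"
abbreviation "W \<equiv> carrier (weyl_group B)"

lemma pairing_eq: "pairing B = p" and roots_eq: "roots B = \<Phi>"
  and h_simple: "\<alpha> \<in> D \<Longrightarrow> h \<alpha> = coroot B \<alpha>"
  using underlying by (auto simp: has_underlying_root_datum_def)

lemma bilinear_p: "bilinear p"
  and simple_two: "\<alpha> \<in> D \<Longrightarrow> p \<alpha> (h \<alpha>) = 2"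
  and simple_ind: "positively_independent D"
  and simple_le: "\<alpha> \<in> D \<Longrightarrow> \<beta> \<in> D \<Longrightarrow> \<alpha> \<noteq> \<beta> \<Longrightarrow> p \<alpha> (h \<beta>) \<le> 0"
  and simple_zero: "\<alpha> \<in> D \<Longrightarrow> \<beta> \<in> D \<Longrightarrow> \<alpha> \<noteq> \<beta> \<Longrightarrow> p \<alpha> (h \<beta>) = 0 \<Longrightarrow> p \<beta> (h \<alpha>) = 0"
  using datum h_simple by (auto simp: based_root_datum_def pairing_eq)

lemma linear_left: "linear (\<lambda>v. p v v')" and linear_right: "linear (p v)"
  using bilinear_p by (auto simp: bilinear_def)

lemma roots_pm: "\<beta> \<in> \<Phi> \<Longrightarrow> \<beta> \<in> nonneg_span D \<or> - \<beta> \<in> nonneg_span D"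
  using datum by (auto simp: based_root_datum_def roots_eq positive_roots_def)

definition s :: "'v \<Rightarrow> 'v \<Rightarrow> 'v" where
  "s \<beta> v = v - p v (h \<beta>) *\<^sub>R \<beta>"

lemma simple_reflection_eq: "\<alpha> \<in> D \<Longrightarrow> simple_reflection B \<alpha> = s \<alpha>"
  by (auto simp: simple_reflection_def reflection_def s_def pairing_eq h_simple)

lemma simple_reflections_eq: "simple_reflections B = s ` D"
  using simple_reflection_eq by (auto simp: simple_reflections_def)

lemma s_GL: "\<alpha> \<in> D \<Longrightarrow> s \<alpha> \<in> carrier GL" and s_s: "\<alpha> \<in> D \<Longrightarrow> s \<alpha> \<circ> s \<alpha> = id"
  using reflection_GL[of p "h \<alpha>" \<alpha>, OF linear_left] simple_two
  by (auto simp: reflection_def s_def[abs_def] o_def)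

lemma group_W: "group (weyl_group B)"
  unfolding weyl_group_def by (rule group.group_subgroup_generated[OF group_GL])

lemma W_mult: "mult (weyl_group B) = (\<circ>)" and W_one: "one (weyl_group B) = id"
  by (simp_all add: weyl_group_def mult_GL one_GL)

lemma W_GL: "W \<subseteq> carrier GL"
  unfolding weyl_group_def by (rule group.carrier_subgroup_generated_subset[OF group_GL])

lemma s_W: "\<alpha> \<in> D \<Longrightarrow> s \<alpha> \<in> W"
  using group.subgroup_generated_subset_carrier_subset[OF group_GL, of "simple_reflections B"]
    s_GL by (auto simp: weyl_group_def simple_reflections_eq)

lemma W_comp: "w \<in> W \<Longrightarrow> u \<in> W \<Longrightarrow> w \<circ> u \<in> W"
  using monoid.m_closed[OF group.is_monoid[OF group_W], of w u] by (simp add: W_mult)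

lemma W_id: "id \<in> W"
  using monoid.one_closed[OF group.is_monoid[OF group_W]] by (simp add: W_one)

lemma W_inverse:
  assumes "w \<in> W" shows "\<exists>u\<in>W. u \<circ> w = id \<and> w \<circ> u = id"
  using group.inv_closed[OF group_W assms] group.l_inv[OF group_W assms] group.r_inv[OF group_W assms]
  by (auto simp: W_mult W_one)

lemma W_linear: "w \<in> W \<Longrightarrow> linear w"
  using W_GL by (auto simp: carrier_GL)

text \<open>Generators are their own inverses, so closure under left multiplication by them
  suffices.\<close>

lemma W_generated:
  assumes id: "id \<in> T" and step: "\<And>\<alpha> w. \<alpha> \<in> D \<Longrightarrow> w \<in> T \<Longrightarrow> s \<alpha> \<circ> w \<in> T"
  shows "W \<subseteq> T"
proof -
  \<comment> \<open>Strengthened from \<open>w \<in> T\<close> to stability of \<open>T\<close>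
    under left multiplication by \<open>w\<close>, which survives products.\<close>
  have "\<forall>u\<in>T. w \<circ> u \<in> T" if "w \<in> generate GL (carrier GL \<inter> s ` D)" for w
    using that
  proof (induction rule: generate.induct)
    case (inv t)
    then obtain \<alpha> where \<alpha>: "\<alpha> \<in> D" "t = s \<alpha>" by blast
    have "inv\<^bsub>GL\<^esub> t = t"
      using s_s[OF \<alpha>(1)] s_GL[OF \<alpha>(1)] \<alpha>(2)
      by (intro group.inv_equality[OF group_GL]) (simp_all add: mult_GL one_GL)
    then show ?case using step[OF \<alpha>(1)] unfolding \<alpha>(2) by metis
  next
    case (incl t)
    then show ?case using step by blast
  next
    case (eng t u)
    then show ?case by (simp add: mult_GL comp_assoc)
  qed (simp add: one_GL)
  from bspec[OF this id] have "w \<in> T" if "w \<in> generate GL (carrier GL \<inter> s ` D)" for w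
    using that by simp
  then show ?thesis by (auto simp: weyl_group_def carrier_subgroup_generated simple_reflections_eq)
qed

lemma W_induct [consumes 1, case_names id reflection]:
  assumes "w \<in> W" "P id" "\<And>\<alpha> w. \<alpha> \<in> D \<Longrightarrow> w \<in> W \<Longrightarrow> P w \<Longrightarrow> P (s \<alpha> \<circ> w)"
  shows "P w"
proof -
  have "W \<subseteq> {w \<in> W. P w}"
    by (rule W_generated) (use assms(2,3) W_id W_comp[OF s_W] in auto)
  then show ?thesis using assms(1) by blast
qed

lemma rho_hom: "w \<in> W \<Longrightarrow> u \<in> W \<Longrightarrow> \<rho> (w \<circ> u) = \<rho> w \<circ> \<rho> u"
  using action by (auto simp: dual_action_def W_mult mult_GL dest: hom_mult)

lemma rho_GL: "w \<in> W \<Longrightarrow> linear (\<rho> w) \<and> bij (\<rho> w)"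
  using action unfolding dual_action_def by (auto dest: hom_in_carrier simp: carrier_GL)

lemma rho_simple:
  assumes "\<alpha> \<in> D" shows "\<rho> (s \<alpha>) v' = v' - p \<alpha> v' *\<^sub>R h \<alpha>"
proof -
  have "inj_on (coroot B) D" using datum by (auto simp: based_root_datum_def bij_betw_def)
  then have "inv_into D (coroot B) (coroot B \<alpha>) = \<alpha>" using assms by simp
  moreover have "\<rho> (s \<alpha>) = simple_reflection (dual B) (coroot B \<alpha>)"
    using action assms simple_reflection_eq[OF assms] by (metis dual_action_def)
  ultimately show ?thesis
    by (simp add: simple_reflection_def reflection_def dual_def pairing_eq h_simple[OF assms])
qed

text \<open>A homomorphism sends the identity to an idempotent, and a bijective idempotent is the
  identity.\<close>

lemma rho_id: "\<rho> id v' = v'"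
proof -
  have "\<rho> id \<circ> \<rho> id = \<rho> id" using rho_hom[OF W_id W_id] by simp
  then have "\<rho> id (\<rho> id v') = \<rho> id v'" by (metis comp_apply)
  then show ?thesis using rho_GL[OF W_id] by (auto dest: bij_is_inj injD)
qed

lemma pairing_invariant:
  assumes "w \<in> W" shows "p (w v) (\<rho> w v') = p v v'"
  using assms
proof (induction arbitrary: v v' rule: W_induct)
  case id
  show ?case by (simp add: rho_id[unfolded id_def])
next
  case (reflection \<alpha> w)
  have "p (x - p x (h \<alpha>) *\<^sub>R \<alpha>) (x' - p \<alpha> x' *\<^sub>R h \<alpha>) = p x x'" for x x'
    using simple_two[OF reflection(1)]
    by (simp add: linear_diff[OF linear_left] linear_diff[OF linear_right]
        linear_scale[OF linear_left] linear_scale[OF linear_right])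
  moreover have "\<rho> (s \<alpha> \<circ> w) v' = \<rho> w v' - p \<alpha> (\<rho> w v') *\<^sub>R h \<alpha>"
    by (simp only: rho_hom[OF s_W[OF reflection(1)] reflection(2)] comp_apply rho_simple[OF reflection(1)])
  moreover have "(s \<alpha> \<circ> w) v = w v - p (w v) (h \<alpha>) *\<^sub>R \<alpha>" by (simp add: s_def)
  ultimately show ?case using reflection(3) by (simp only:)
qed

lemma rootE:
  assumes "\<beta> \<in> \<Phi>" obtains w \<alpha> where "w \<in> W" "\<alpha> \<in> D" "\<beta> = w \<alpha>"
  using assms by (auto simp: roots_def simp flip: roots_eq)

lemma simple_root: "\<alpha> \<in> D \<Longrightarrow> \<alpha> \<in> \<Phi>"
  unfolding roots_eq[symmetric] roots_def
  by (intro CollectI exI[of _ id] exI[of _ \<alpha>] conjI W_id) auto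

lemma W_root:
  assumes "w \<in> W" "\<beta> \<in> \<Phi>" shows "w \<beta> \<in> \<Phi>"
proof -
  obtain u \<alpha> where u: "u \<in> W" "\<alpha> \<in> D" "\<beta> = u \<alpha>" using rootE[OF assms(2)] by blast
  then have "w \<beta> = (w \<circ> u) \<alpha>" by simp
  then show ?thesis using W_comp[OF assms(1) u(1)] u(2) unfolding roots_eq[symmetric] roots_def by blast
qed

lemma equivariant: "w \<in> W \<Longrightarrow> \<beta> \<in> \<Phi> \<Longrightarrow> p (w v) (h (w \<beta>)) = p v (h \<beta>)"
  by (simp add: h_equivariant pairing_invariant)

lemma s_conjugate:
  assumes "w \<in> W" "\<beta> \<in> \<Phi>" shows "s (w \<beta>) \<circ> w = w \<circ> s \<beta>"
  by (simp add: fun_eq_iff s_def equivariant[OF assms] linear_diff[OF W_linear] linear_scale[OF W_linear] assms)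

lemma root_reflection_W:
  assumes "\<beta> \<in> \<Phi>" shows "s \<beta> \<in> W"
proof -
  obtain w \<alpha> where w: "w \<in> W" "\<alpha> \<in> D" "\<beta> = w \<alpha>" using rootE[OF assms] by blast
  obtain u where u: "u \<in> W" "u \<circ> w = id" "w \<circ> u = id" using W_inverse[OF w(1)] by blast
  have "s \<beta> = (s \<beta> \<circ> w) \<circ> u" using u(3) by (simp add: comp_assoc)
  also have "\<dots> = w \<circ> s \<alpha> \<circ> u" using s_conjugate[OF w(1) simple_root[OF w(2)]] w(3) by simp
  finally show ?thesis using w u s_W W_comp by simp
qed

sublocale root_system \<Phi> "\<lambda>\<beta> v. p v (h \<beta>)" W
proof (rule root_system.intro)
  fix \<beta> assume \<beta>: "\<beta> \<in> \<Phi>"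
  obtain w \<alpha> where w: "w \<in> W" "\<alpha> \<in> D" "\<beta> = w \<alpha>" using rootE[OF \<beta>] by blast
  then show "p \<beta> (h \<beta>) = 2" using equivariant[OF w(1) simple_root[OF w(2)], of \<alpha>] simple_two by simp
  show "(\<lambda>v. v - p v (h \<beta>) *\<^sub>R \<beta>) \<in> W" using root_reflection_W[OF \<beta>] by (simp add: s_def[abs_def])
qed (use linear_left W_id W_comp W_linear W_inverse W_root equivariant in blast)+

lemma rf_eq: "rf = s"
  by (simp add: fun_eq_iff rf_def s_def)

text \<open>Finite rank concerns reflections, so \<open>s\<close> has to be injective on
  \<open>D\<close>. If \<open>s \<alpha> = s \<beta>\<close>, then \<open>2 *\<^sub>R \<alpha> + (-
  p \<alpha> (h \<beta>)) *\<^sub>R \<beta> = 0\<close> with nonnegative coefficients, against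
  positive independence.\<close>

lemma finite_simple_roots:
  assumes "finite (simple_reflections B)" shows "finite D"
proof -
  have "inj_on s D"
  proof (rule inj_onI, rule ccontr)
    fix \<alpha> \<beta> assume ab: "\<alpha> \<in> D" "\<beta> \<in> D" "s \<alpha> = s \<beta>" "\<alpha> \<noteq> \<beta>"
    have "s \<alpha> \<alpha> = - \<alpha>" using simple_two[OF ab(1)] by (simp add: s_def scaleR_2)
    then have "\<alpha> - p \<alpha> (h \<beta>) *\<^sub>R \<beta> = - \<alpha>" using ab(3) by (simp add: s_def)
    then have "2 *\<^sub>R \<alpha> + (- p \<alpha> (h \<beta>)) *\<^sub>R \<beta> = 0" by (simp add: scaleR_2 algebra_simps eq_neg_iff_add_eq_0)
    then have sum: "(\<Sum>x\<in>{\<alpha>, \<beta>}. (if x = \<alpha> then 2 else - p \<alpha> (h \<beta>)) *\<^sub>R x) = 0" using ab(4) by simp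
    have "(if \<alpha> = \<alpha> then 2 else - p \<alpha> (h \<beta>)) = 0"
      using ab(1,2) simple_le[OF ab(1,2,4)] sum
      by (intro simple_ind[unfolded positively_independent_def, rule_format, of "{\<alpha>, \<beta>}"
            "\<lambda>x. if x = \<alpha> then 2 else - p \<alpha> (h \<beta>)" \<alpha>]) auto
    then show False by simp
  qed
  then show ?thesis using assms finite_imageD simple_reflections_eq by metis
qed

lemma root_base_simple:
  assumes "finite D" shows "root_base D"
  unfolding root_base_def rf_eq
proof (intro conjI ballI allI impI)
  fix T assume "id \<in> T" "\<forall>\<alpha>\<in>D. \<forall>w\<in>T. s \<alpha> \<circ> w \<in> T"
  then show "W \<subseteq> T" by (intro W_generated) auto
qed (use assms simple_root simple_ind roots_pm simple_le simple_zero in auto)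

text \<open>Irreducibility concerns orders of products, connectedness concerns pairings. Where the
  pairing vanishes, the two reflections commute and their product has order 2, so there is no edge.
  Paths are followed among reflections and pulled back, since distinct simple roots have distinct
  reflections.\<close>

lemma connected_base_simple:
  assumes "finite D" and irr: "irreducible_coxeter (weyl_group B) (simple_reflections B)"
  shows "connected_base D"
  unfolding connected_base_def
proof (intro allI impI)
  fix A assume A: "A \<subseteq> D" "A \<noteq> {}"
    and closed: "\<forall>\<alpha>\<in>A. \<forall>\<beta>\<in>D. \<alpha> \<noteq> \<beta> \<longrightarrow> p \<alpha> (h \<beta>) \<noteq> 0 \<longrightarrow> \<beta> \<in> A"
  note base = root_base_simple[OF assms(1)]
  have step: "t \<in> s ` A" if rt_edge: "r \<in> s ` A" "(r, t) \<in> coxeter_graph (weyl_group B) (simple_reflections B)" for r t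
  proof -
    obtain \<alpha> where \<alpha>: "\<alpha> \<in> A" "r = s \<alpha>" using rt_edge(1) by blast
    obtain \<beta> where \<beta>: "\<beta> \<in> D" "t = s \<beta>"
      using rt_edge(2) by (auto simp: coxeter_graph_def simple_reflections_eq)
    have ne: "r \<noteq> t" and ord: "group.ord (weyl_group B) (r \<circ> t) \<noteq> 2"
      using rt_edge(2) by (auto simp: coxeter_graph_def W_mult)
    have aD: "\<alpha> \<in> D" using \<alpha> A by blast
    have rt: "r \<in> W" "t \<in> W" using s_W \<alpha>(2) \<beta> aD by auto
    have sq: "r \<circ> r = id" "t \<circ> t = id" using s_s \<alpha>(2) \<beta> aD by auto
    have "p \<alpha> (h \<beta>) \<noteq> 0"
    proof
      assume zero: "p \<alpha> (h \<beta>) = 0"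
      moreover have "p \<beta> (h \<alpha>) = 0" using simple_zero[OF aD \<beta>(1)] zero ne \<alpha> \<beta> by blast
      ultimately have "r \<circ> t = t \<circ> r"
        by (simp add: \<alpha> \<beta> fun_eq_iff s_def linear_diff[OF linear_left] linear_scale[OF linear_left])
      then have "(r \<circ> t) \<circ> (r \<circ> t) = id" by (metis comp_assoc comp_id sq)
      then have "(r \<circ> t) [^]\<^bsub>weyl_group B\<^esub> (2::nat) = \<one>\<^bsub>weyl_group B\<^esub>"
        by (simp add: numeral_2_eq_2 W_mult W_one)
      then have "group.ord (weyl_group B) (r \<circ> t) dvd 2"
        using group.pow_eq_id[OF group_W W_comp[OF rt]] by blast
      moreover have "group.ord (weyl_group B) (r \<circ> t) \<noteq> 1"
      proof
        assume "group.ord (weyl_group B) (r \<circ> t) = 1"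
        then have "r \<circ> t = id" using group.ord_eq_1[OF group_W W_comp[OF rt]] by (simp add: W_one)
        then show False using ne sq by (metis comp_assoc comp_id id_comp)
      qed
      ultimately show False using ord two_is_prime_nat prime_nat_iff by blast
    qed
    moreover have "\<alpha> \<noteq> \<beta>" using ne \<alpha> \<beta> by blast
    ultimately have "\<beta> \<in> A" using closed \<alpha>(1) \<beta>(1) by blast
    then show ?thesis using \<beta>(2) by blast
  qed
  show "A = D"
  proof
    show "D \<subseteq> A"
    proof
      fix \<beta> assume \<beta>: "\<beta> \<in> D"
      obtain \<alpha> where \<alpha>: "\<alpha> \<in> A" using A by blast
      have "(s \<alpha>, s \<beta>) \<in> (coxeter_graph (weyl_group B) (simple_reflections B))\<^sup>*"
        using irr \<alpha> A \<beta> by (auto simp: irreducible_coxeter_def simple_reflections_eq)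
      then have "s \<beta> \<in> s ` A"
        by (induction rule: rtrancl_induct) (use \<alpha> step in auto)
      then obtain \<gamma> where \<gamma>: "\<gamma> \<in> A" "s \<beta> = s \<gamma>" by blast
      have gD: "\<gamma> \<in> D" using \<gamma> A by blast
      have "\<beta> = \<gamma>"
      proof (rule ccontr)
        assume ne: "\<beta> \<noteq> \<gamma>"
        have "s \<beta> \<beta> = - \<beta>" using rf_self[OF simple_root[OF \<beta>]] by (simp add: rf_eq)
        then have "\<beta> + \<beta> = p \<beta> (h \<gamma>) *\<^sub>R \<gamma>" using \<gamma>(2) by (simp add: s_def algebra_simps)
        then obtain t where "t \<ge> 0" "\<beta> = t *\<^sub>R \<gamma>"
          using base_extremal[OF base gD nonneg_span_base[OF \<beta>] nonneg_span_base[OF \<beta>]] by blast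
        then show False using base_proportional[OF base gD \<beta>] ne by blast
      qed
      then show "\<beta> \<in> A" using \<gamma>(1) by simp
    qed
  qed (rule A(1))
qed

text \<open>Conjugation carries \<open>rho_simple\<close> along the orbit of a simple root;
  \<open>\<rho> w\<close> is bijective, so every \<open>v'\<close> has the form
  \<open>\<rho> w x\<close>.\<close>

lemma rho_reflection:
  assumes "\<beta> \<in> \<Phi>" shows "\<rho> (s \<beta>) v' = v' - p \<beta> v' *\<^sub>R h \<beta>"
proof -
  obtain w \<alpha> where w: "w \<in> W" "\<alpha> \<in> D" "\<beta> = w \<alpha>" using rootE[OF assms] by blast
  have lin: "linear (\<rho> w)" using rho_GL[OF w(1)] by blast
  obtain x where x: "v' = \<rho> w x" using rho_GL[OF w(1)] by (meson bij_pointE)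
  have "\<rho> (s \<beta>) \<circ> \<rho> w = \<rho> w \<circ> \<rho> (s \<alpha>)"
    using s_conjugate[OF w(1) simple_root[OF w(2)]] w
      rho_hom[OF root_reflection_W[OF assms] w(1)] rho_hom[OF w(1) s_W[OF w(2)]] by simp
  then have "\<rho> (s \<beta>) v' = \<rho> w (x - p \<alpha> x *\<^sub>R h \<alpha>)"
    unfolding x by (metis comp_apply rho_simple[OF w(2)])
  also have "\<dots> = v' - p \<beta> v' *\<^sub>R h \<beta>"
    by (simp add: x w(3) linear_diff[OF lin] linear_scale[OF lin] pairing_invariant[OF w(1)]
        h_equivariant[OF w(1) simple_root[OF w(2)]])
  finally show ?thesis .
qed

text \<open>Both reflections send \<open>\<beta>\<close> to \<open>-\<beta>\<close>; comparing what they do to its coroot determines the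
  coroot of \<open>k\<beta>\<close>, even where the pairing is degenerate.\<close>

lemma reflection_multiple:
  assumes \<beta>: "\<beta> \<in> \<Phi>" and k: "k *\<^sub>R \<beta> \<in> \<Phi>" shows "s (k *\<^sub>R \<beta>) = s \<beta>"
proof -
  have two: "k * p \<beta> (h (k *\<^sub>R \<beta>)) = 2"
    using cr_self[OF k] by (simp add: linear_scale[OF linear_left])
  have "s (k *\<^sub>R \<beta>) \<beta> = \<beta> - (k * p \<beta> (h (k *\<^sub>R \<beta>))) *\<^sub>R \<beta>" by (simp add: s_def mult.commute)
  then have "s (k *\<^sub>R \<beta>) \<beta> = - \<beta>" unfolding two by (simp add: scaleR_2)
  moreover have "s \<beta> \<beta> = - \<beta>" using rf_self[OF \<beta>] by (simp add: rf_eq)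
  ultimately have "\<rho> (s (k *\<^sub>R \<beta>)) (h \<beta>) = \<rho> (s \<beta>) (h \<beta>)"
    using h_equivariant[OF root_reflection_W[OF k] \<beta>] h_equivariant[OF root_reflection_W[OF \<beta>] \<beta>] by simp
  then have "(2 * k) *\<^sub>R h (k *\<^sub>R \<beta>) = 2 *\<^sub>R h \<beta>"
    using cr_self[OF \<beta>]
    by (simp add: rho_reflection[OF k] rho_reflection[OF \<beta>] linear_scale[OF linear_left] mult.commute)
  then have "2 *\<^sub>R (k *\<^sub>R h (k *\<^sub>R \<beta>)) = 2 *\<^sub>R h \<beta>" by simp
  then have hk: "h \<beta> = k *\<^sub>R h (k *\<^sub>R \<beta>)" by (simp only: scaleR_cancel_left) simp
  show ?thesis
    unfolding fun_eq_iff s_def hk linear_scale[OF linear_right] by (simp add: mult.commute)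
qed

lemma conjugate_reflection:
  assumes "w \<in> W" "\<beta> \<in> \<Phi>"
  shows "w \<otimes>\<^bsub>weyl_group B\<^esub> s \<beta> \<otimes>\<^bsub>weyl_group B\<^esub> inv\<^bsub>weyl_group B\<^esub> w = s (w \<beta>)"
proof -
  have "w \<otimes>\<^bsub>weyl_group B\<^esub> s \<beta> = s (w \<beta>) \<otimes>\<^bsub>weyl_group B\<^esub> w"
    using s_conjugate[OF assms] by (simp add: W_mult)
  then show ?thesis
    using group.inv_solve_right'[OF group_W, of "s (w \<beta>)"] assms root_reflection_W W_root
    by (metis group.inv_closed group.is_monoid group.r_inv group_W monoid.m_assoc monoid.r_one)
qed

end

lemma (in group) conjugation_iso:
  assumes "w \<in> carrier G"
  shows "(\<lambda>x. w \<otimes> x \<otimes> inv w) \<in> iso G G"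
proof -
  have cancel: "inv w \<otimes> (w \<otimes> a) = a" "w \<otimes> (inv w \<otimes> a) = a" if "a \<in> carrier G" for a
    using assms that by (simp_all flip: m_assoc)
  have "(\<lambda>x. w \<otimes> x \<otimes> inv w) \<in> hom G G"
    by (rule homI) (use assms in \<open>simp_all add: m_assoc cancel\<close>)
  moreover have "bij_betw (\<lambda>x. w \<otimes> x \<otimes> inv w) (carrier G) (carrier G)"
    by (rule bij_betw_byWitness[of _ "\<lambda>x. inv w \<otimes> x \<otimes> w"])
      (use assms in \<open>auto simp: m_assoc cancel\<close>)
  ultimately show ?thesis by (simp add: iso_def)
qed

theorem theorem3p3:
  fixes B B' :: "('v::real_vector, 'w::real_vector) root_basis"
    and p :: "'v \<Rightarrow> 'w \<Rightarrow> real"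
    and \<Phi> :: "'v set" and \<Phi>' :: "'w set" and h :: "'v \<Rightarrow> 'w"
  assumes "based_root_datum B" and "based_root_datum B'"
    and "has_underlying_root_datum B p \<Phi> \<Phi>' h"
    and "has_underlying_root_datum B' p \<Phi> \<Phi>' h"
    and "finite (simple_reflections B)" and "finite (simple_reflections B')"
    and "irreducible_coxeter (weyl_group B) (simple_reflections B)"
    and "irreducible_coxeter (weyl_group B') (simple_reflections B')"
  shows "(\<exists>w \<in> carrier (weyl_group B). \<exists>\<epsilon> \<in> {1, -1 :: real}. \<exists>c :: 'v \<Rightarrow> real.
            (\<forall>\<alpha> \<in> simple_roots B. 0 < c \<alpha>) \<and>
            simple_roots B' = {(\<epsilon> * c \<alpha>) *\<^sub>R w \<alpha> | \<alpha>. \<alpha> \<in> simple_roots B} \<and>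
            simple_reflections B' =
              {w \<otimes>\<^bsub>weyl_group B\<^esub> s \<otimes>\<^bsub>weyl_group B\<^esub> inv\<^bsub>weyl_group B\<^esub> w | s. s \<in> simple_reflections B})
       \<and> coxeter_isomorphic (weyl_group B) (simple_reflections B)
                            (weyl_group B') (simple_reflections B')"
proof -
  obtain \<rho> where "dual_action B \<rho>" "\<forall>w\<in>carrier (weyl_group B). \<forall>\<beta>\<in>\<Phi>. h (w \<beta>) = \<rho> w (h \<beta>)"
    using assms(3) unfolding has_underlying_root_datum_def by blast
  then interpret B: rooted_datum B p \<Phi> \<Phi>' h \<rho> using assms by unfold_locales auto
  obtain \<rho>' where "dual_action B' \<rho>'" "\<forall>w\<in>carrier (weyl_group B'). \<forall>\<beta>\<in>\<Phi>. h (w \<beta>) = \<rho>' w (h \<beta>)"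
    using assms(4) unfolding has_underlying_root_datum_def by blast
  then interpret B': rooted_datum B' p \<Phi> \<Phi>' h \<rho>' using assms by unfold_locales auto
  \<comment> \<open>The data share the roots and the map \<open>h\<close>, so each simple reflection
    of one datum is the reflection in a root of the other.\<close>
  have "B'.W \<subseteq> B.W"
    by (rule B'.W_generated)
      (use B.W_id B.W_comp B.root_reflection_W B'.simple_root in auto)
  moreover have "B.W \<subseteq> B'.W"
    by (rule B.W_generated)
      (use B'.W_id B'.W_comp B'.root_reflection_W B.simple_root in auto)
  ultimately have W_eq: "B'.W = B.W" by blast
  then have group_eq: "weyl_group B' = weyl_group B"
    by (simp add: weyl_group_def subgroup_generated_def)
  have base: "B.root_base B.D"
    by (rule B.root_base_simple[OF B.finite_simple_roots[OF assms(5)]])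
  \<comment> \<open>Once the groups agree, both interpretations have the same parameters, and
    \<open>root_base\<close> is the same predicate in both.\<close>
  have base': "B.root_base B'.D"
    using B'.root_base_simple[OF B'.finite_simple_roots[OF assms(6)]] by (simp add: W_eq)
  have conn: "B.connected_base B.D"
    by (rule B.connected_base_simple[OF B.finite_simple_roots[OF assms(5)] assms(7)])
  obtain w \<epsilon> c where w: "w \<in> B.W" and \<epsilon>: "\<epsilon> \<in> {1, -1 :: real}" and c: "\<forall>\<alpha>\<in>B.D. 0 < c \<alpha>"
    and D': "B'.D = {(\<epsilon> * c \<alpha>) *\<^sub>R w \<alpha> | \<alpha>. \<alpha> \<in> B.D}"
    using B.bases_conjugate[OF base base' conn] by blast
  have "simple_reflections B' = (\<lambda>\<alpha>. B.s ((\<epsilon> * c \<alpha>) *\<^sub>R w \<alpha>)) ` B.D"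
    unfolding B'.simple_reflections_eq D' Setcompr_eq_image image_image ..
  also have "\<dots> = (\<lambda>\<alpha>. w \<otimes>\<^bsub>weyl_group B\<^esub> B.s \<alpha> \<otimes>\<^bsub>weyl_group B\<^esub> inv\<^bsub>weyl_group B\<^esub> w) ` B.D"
  proof (rule image_cong[OF refl])
    fix \<alpha> assume \<alpha>: "\<alpha> \<in> B.D"
    then have "(\<epsilon> * c \<alpha>) *\<^sub>R w \<alpha> \<in> B'.D" unfolding D' by blast
    \<comment> \<open>Both vectors are roots, the scaled one because it lies in the second base, so
      the factor does not affect the reflection.\<close>
    then have "B.s ((\<epsilon> * c \<alpha>) *\<^sub>R w \<alpha>) = B.s (w \<alpha>)"
      by (intro B.reflection_multiple B.W_root[OF w] B.simple_root[OF \<alpha>] B'.simple_root)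
    then show "B.s ((\<epsilon> * c \<alpha>) *\<^sub>R w \<alpha>) =
        w \<otimes>\<^bsub>weyl_group B\<^esub> B.s \<alpha> \<otimes>\<^bsub>weyl_group B\<^esub> inv\<^bsub>weyl_group B\<^esub> w"
      by (simp only: B.conjugate_reflection[OF w B.simple_root[OF \<alpha>]])
  qed
  finally have S': "simple_reflections B' =
    {w \<otimes>\<^bsub>weyl_group B\<^esub> s \<otimes>\<^bsub>weyl_group B\<^esub> inv\<^bsub>weyl_group B\<^esub> w | s. s \<in> simple_reflections B}"
    unfolding B.simple_reflections_eq Setcompr_eq_image image_image .
  then have "coxeter_isomorphic (weyl_group B) (simple_reflections B)
      (weyl_group B') (simple_reflections B')"
    unfolding coxeter_isomorphic_def group_eq
    by (intro bexI[OF _ group.conjugation_iso[OF B.group_W w]]) (simp only: Setcompr_eq_image)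
  moreover have "\<exists>\<epsilon> \<in> {1, -1 :: real}. \<exists>c. (\<forall>\<alpha> \<in> B.D. 0 < c \<alpha>) \<and>
      B'.D = {(\<epsilon> * c \<alpha>) *\<^sub>R w \<alpha> | \<alpha>. \<alpha> \<in> B.D} \<and> simple_reflections B' =
        {w \<otimes>\<^bsub>weyl_group B\<^esub> s \<otimes>\<^bsub>weyl_group B\<^esub> inv\<^bsub>weyl_group B\<^esub> w | s. s \<in> simple_reflections B}"
    by (intro bexI[OF _ \<epsilon>] exI[of _ c] conjI c D' S')
  ultimately show ?thesis using w by (intro conjI bexI[of _ w])
qed

end
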